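(* Let $k>l$ be positive integers, and let $G$ be a finite abelian group of order $n>1$ and exponent $v$. Then the maximum size $\lambda_{k,l}(G)$ of a $(k,l)$-sum-free set in $G$ satisfies $$\max_{d \mid v} \left\{ \left( \left \lfloor \frac{d-1 - \delta(d)}{k+l} \right \rfloor +1 \right) \cdot \frac{n}{d} \right\} \leq \lambda_{k,l}(G) \leq \max_{d \mid n} \left\{ \left( \left \lfloor \frac{d-2}{k+l} \right \rfloor +1 \right) \cdot \frac{n}{d} \right\},$$ where $\delta(d) = \gcd (d, k-l)$, and the maxima run over all positive divisors $d$ of $v$ and of $n$, respectively.
   Context: $G$ is written additively; its exponent $v$ is the largest order of any element of $G$. For a positive integer $h$ and a subset $A\subseteq G$, $hA$ denotes the set of all sums of $h$ (not necessarily distinct) elements of $A$. For distinct positive integers $k,l$, a subset $A\subseteq G$ is called $(k,l)$-sum-free if $kA\cap lA=\emptyset$. $\lambda_{k,l}(G)$ denotes the maximum size of a $(k,l)$-sum-free subset of $G$ (the empty set counts as $(k,l)$-sum-free, so $\lambda_{k,l}(G)=0$ if no nonempty such set exists). *)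

theory Defs
  imports Complex_Main "HOL-Algebra.Multiplicative_Group"
begin

(* Groups are HOL-Algebra structures, so the operation of an additively written
   abelian group G is denoted multiplicatively: the sum a_1 + ... + a_h is finprod. *)

definition hfold_sumset :: "('a, 'b) monoid_scheme \<Rightarrow> nat \<Rightarrow> 'a set \<Rightarrow> 'a set" where
  "hfold_sumset G h A = {finprod G a {..<h} | a. a \<in> {..<h} \<rightarrow> A}"

definition sum_free :: "('a, 'b) monoid_scheme \<Rightarrow> nat \<Rightarrow> nat \<Rightarrow> 'a set \<Rightarrow> bool" where
  "sum_free G k l A \<longleftrightarrow>
     A \<subseteq> carrier G \<and> hfold_sumset G k A \<inter> hfold_sumset G l A = {}"

(* For k, l > 0 the empty set is sum-free, so Max is taken over a nonempty set. *)
definition max_sum_free_size :: "('a, 'b) monoid_scheme \<Rightarrow> nat \<Rightarrow> nat \<Rightarrow> nat" where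
  "max_sum_free_size G k l = Max {card A | A. sum_free G k l A}"

definition group_exponent :: "('a, 'b) monoid_scheme \<Rightarrow> nat" where
  "group_exponent G = Max (group.ord G ` carrier G)"

end

theory Submission
  imports Defs "HOL-Number_Theory.Cong"
begin

text \<open>
  The group operation is written as a product below, as in the formal statement.

  The upper bound comes from Kneser's addition theorem. If \<open>A\<close> is \<open>(k,l)\<close>-sum-free, then the
  product \<open>S\<close> of \<open>k\<close> copies of \<open>A\<close> and \<open>l\<close> copies of the set of inverses of \<open>A\<close> does not contain
  \<open>\<one>\<close>. Let \<open>K\<close> be the stabilizer of \<open>S\<close>, put \<open>d = n / |K|\<close>, and let \<open>A\<close> meet \<open>m\<close> cosets of \<open>K\<close>.
  Since \<open>S\<close> is a union of cosets of \<open>K\<close> other than \<open>K\<close> itself, it has at most \<open>d - 1\<close> of them; Kneser's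
  theorem says that it has at least \<open>(k + l) m - (k + l - 1)\<close>. Hence \<open>(k + l) (m - 1) \<le> d - 2\<close>, and
  \<open>|A| \<le> m |K| = m n / d\<close>. This is \<open>sum_free_card_le\<close>, which rests on \<open>kneser_addition\<close> and its
  version \<open>kneser_sumset\<close> for many factors.

  Kneser's theorem for two sets is proved by an intersection-union argument due to DeVos. After a
  translation one may suppose that \<open>A\<close> meets \<open>B\<close> without being contained in it, so that induction
  applies to the pair \<open>A \<inter> B\<close>, \<open>A \<union> B\<close>, whose product lies in \<open>A B\<close>. This bounds \<open>|A B|\<close> from below up
  to an error governed by some subgroup \<open>H\<close>; the subgroup is then made as small as possible, and the
  minimal one turns out to stabilize \<open>A B\<close>, which is all that is needed (\<open>convergent_descent\<close>).

  The lower bound is a construction. The exponent \<open>v\<close> is the order of an element \<open>g\<close>, every element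
  of the group has order dividing \<open>v\<close>, and so the homomorphism from the subgroup generated by \<open>g\<close> to
  \<open>\<int>/v\<close> that sends \<open>g\<close> to \<open>1\<close> extends to the whole group (\<open>hom_mod_maximal_ord\<close>). For \<open>d dvd v\<close> it
  induces a homomorphism onto \<open>\<int>/d\<close>, all of whose fibres have \<open>n / d\<close> elements. The preimage of an
  interval of \<open>q + 1\<close> consecutive residues is sum-free if the interval is well placed, and a good
  place exists as soon as \<open>(k + l) q \<le> d - 1 - gcd d (k - l)\<close> (\<open>interval_sum_free\<close>).
\<close>

no_notation subset_mset (infix \<open><#\<close> 50)

section \<open>Sumsets, periods and stabilizers\<close>

locale finite_comm_group = comm_group +
  assumes finite_carrier: "finite (carrier G)"
begin

lemma in_set_mult_iff: "x \<in> A <#> B \<longleftrightarrow> (\<exists>a\<in>A. \<exists>b\<in>B. x = a \<otimes> b)"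
  by (auto simp: set_mult_def)

lemma set_multI: "a \<in> A \<Longrightarrow> b \<in> B \<Longrightarrow> a \<otimes> b \<in> A <#> B"
  by (auto simp: set_mult_def)

lemma set_mult_comm:
  assumes "A \<subseteq> carrier G" "B \<subseteq> carrier G"
  shows "A <#> B = B <#> A"
proof -
  have "a \<otimes> b = b \<otimes> a" if "a \<in> A" "b \<in> B" for a b
    using assms that by (intro m_comm) auto
  then show ?thesis unfolding set_eq_iff in_set_mult_iff by metis
qed

lemma finite_sub: "A \<subseteq> carrier G \<Longrightarrow> finite A"
  using finite_carrier finite_subset by blast

lemma in_l_coset_iff:
  assumes "x \<in> carrier G" "y \<in> carrier G" "H \<subseteq> carrier G"
  shows "y \<in> x <# H \<longleftrightarrow> inv x \<otimes> y \<in> H"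
proof
  assume "y \<in> x <# H"
  then obtain h where h: "h \<in> H" "y = x \<otimes> h" by (auto simp: l_coset_def)
  then show "inv x \<otimes> y \<in> H" using assms
    by (auto simp: subset_iff simp flip: m_assoc)
next
  assume "inv x \<otimes> y \<in> H"
  moreover have "y = x \<otimes> (inv x \<otimes> y)" using assms
    by (simp flip: m_assoc)
  ultimately show "y \<in> x <# H" by (auto simp: l_coset_def)
qed

lemma card_l_coset:
  assumes "x \<in> carrier G" "A \<subseteq> carrier G"
  shows "card (x <# A) = card A"
proof -
  have "x <# A = (\<otimes>) x ` A" by (auto simp: l_coset_def)
  moreover have "inj_on ((\<otimes>) x) A"
    using assms by (meson inj_on_multc inj_on_subset inj_on_cmult)
  ultimately show ?thesis by (simp add: card_image)
qed

lemma l_coset_carrier: "x \<in> carrier G \<Longrightarrow> A \<subseteq> carrier G \<Longrightarrow> x <# A \<subseteq> carrier G"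
  by (simp add: l_coset_subset_G)

lemma set_mult_l_coset:
  assumes "x \<in> carrier G" "A \<subseteq> carrier G" "B \<subseteq> carrier G"
  shows "(x <# A) <#> B = x <# (A <#> B)"
  using set_mult_assoc[of "{x}" A B] assms by (simp add: l_coset_eq_set_mult)

lemma l_coset_mem_self: "subgroup H G \<Longrightarrow> x \<in> carrier G \<Longrightarrow> x \<in> x <# H"
  by (metis in_l_coset_iff l_inv subgroup.one_closed subgroup.subset)

lemma l_coset_eqI:
  assumes "subgroup H G" "x \<in> carrier G" "y \<in> x <# H"
  shows "y <# H = x <# H"
  using l_repr_independence[OF assms(3,2,1)] by simp

lemma l_coset_disjoint:
  assumes "subgroup H G" "x \<in> carrier G" "y \<in> carrier G" "x <# H \<noteq> y <# H"
  shows "(x <# H) \<inter> (y <# H) = {}"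
proof (rule ccontr)
  assume "(x <# H) \<inter> (y <# H) \<noteq> {}"
  then obtain z where "z \<in> x <# H" "z \<in> y <# H" by auto
  then show False using l_coset_eqI[of H x z] l_coset_eqI[of H y z] assms by simp
qed

lemma superset_set_mult_subgroup:
  assumes "subgroup H G" "A \<subseteq> carrier G"
  shows "A \<subseteq> A <#> H"
proof
  fix a assume "a \<in> A"
  then have "a \<otimes> \<one> \<in> A <#> H" using assms by (intro set_multI) (auto simp: subgroup.one_closed)
  then show "a \<in> A <#> H" using \<open>a \<in> A\<close> assms by auto
qed

lemma set_mult_subgroup_idem:
  assumes "subgroup H G" "A \<subseteq> carrier G"
  shows "(A <#> H) <#> H = A <#> H"
  using assms by (simp add: set_mult_assoc subgroup.subset subgroup_mult_id)

lemma set_mult_subgroup_mono: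
  assumes "subgroup H G" "subgroup J G" "J \<subseteq> H" "A \<subseteq> carrier G"
  shows "A <#> J \<subseteq> A <#> H"
  using assms by (intro mono_set_mult) auto

text \<open>
  The equivalence, rather than just the implication from right to left, makes closure
  under inverses immediate.
\<close>

definition stab :: "'a set \<Rightarrow> 'a set" where
  "stab C = {g \<in> carrier G. \<forall>x\<in>carrier G. x \<otimes> g \<in> C \<longleftrightarrow> x \<in> C}"

lemma subgroup_stab: "subgroup (stab C) G"
proof (rule subgroupI)
  show "stab C \<subseteq> carrier G" by (auto simp: stab_def)
  show "stab C \<noteq> {}" by (auto simp: stab_def intro!: exI[of _ \<one>])
next
  fix a assume a: "a \<in> stab C"
  have "x \<otimes> inv a \<in> C \<longleftrightarrow> x \<in> C" if x: "x \<in> carrier G" for x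
  proof -
    have "(x \<otimes> inv a) \<otimes> a = x" using a x by (simp add: stab_def m_assoc)
    then show ?thesis using a x by (metis (mono_tags, lifting) inv_closed m_closed mem_Collect_eq stab_def)
  qed
  then show "inv a \<in> stab C" using a by (auto simp: stab_def)
next
  fix a b assume "a \<in> stab C" "b \<in> stab C"
  then show "a \<otimes> b \<in> stab C" by (auto simp: stab_def simp flip: m_assoc)
qed

lemma stab_carrier: "stab C \<subseteq> carrier G"
  by (auto simp: stab_def)

lemma set_mult_stab:
  assumes "C \<subseteq> carrier G"
  shows "C <#> stab C = C"
proof
  show "C <#> stab C \<subseteq> C" using subsetD[OF assms] by (auto simp: in_set_mult_iff stab_def)
  show "C \<subseteq> C <#> stab C" by (simp add: assms subgroup_stab superset_set_mult_subgroup)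
qed

lemma subset_stab:
  assumes H: "subgroup H G" and C: "C \<subseteq> carrier G" "C <#> H = C"
  shows "H \<subseteq> stab C"
proof
  fix h assume h: "h \<in> H"
  then have hc: "h \<in> carrier G" using subgroup.mem_carrier[OF H] by simp
  have "x \<in> C" if "x \<in> carrier G" "x \<otimes> h \<in> C" for x
  proof -
    have "(x \<otimes> h) \<otimes> inv h \<in> C <#> H"
      by (intro set_multI that subgroup.m_inv_closed[OF H h])
    moreover have "(x \<otimes> h) \<otimes> inv h = x" using that(1) hc by (simp add: m_assoc)
    ultimately show ?thesis unfolding C(2) by simp
  qed
  moreover have "x \<otimes> h \<in> C" if "x \<in> C" for x
    using set_multI[OF that h] unfolding C(2) .
  ultimately show "h \<in> stab C" unfolding stab_def using hc by blast
qed

lemma stab_set_mult_mono: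
  assumes "A \<subseteq> carrier G" "B \<subseteq> carrier G"
  shows "stab B \<subseteq> stab (A <#> B)"
  using assms by (intro subset_stab subgroup_stab) (simp_all add: set_mult_assoc set_mult_stab set_mult_closed stab_carrier)

text \<open>
  This invariance under translation allows the two factors to be moved into a convenient
  relative position without changing any quantity in Kneser's theorem.
\<close>

lemma stab_l_coset:
  assumes x: "x \<in> carrier G" and C: "C \<subseteq> carrier G"
  shows "stab (x <# C) = stab C"
proof -
  have le: "stab D \<subseteq> stab (y <# D)" if "y \<in> carrier G" "D \<subseteq> carrier G" for y D
    using stab_set_mult_mono[of "{y}" D] that by (simp add: l_coset_eq_set_mult)
  have "inv x <# (x <# C) = C" using x C by (simp add: lcos_m_assoc lcos_mult_one)
  then show ?thesis using le[OF x C] le[of "inv x" "x <# C"] x C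
    by (simp add: l_coset_carrier)
qed

lemma period_dvd_card:
  assumes H: "subgroup H G" and C: "C \<subseteq> carrier G" "C <#> H = C"
  shows "card H dvd card C"
proof -
  let ?P = "(\<lambda>x. x <# H) ` C"
  have Hc: "H \<subseteq> carrier G" using H subgroup.subset by blast
  have U: "\<Union>?P = C"
  proof
    show "\<Union>?P \<subseteq> C" using C by (auto simp: set_mult_def l_coset_def)
    show "C \<subseteq> \<Union>?P" using l_coset_mem_self[OF H] C by blast
  qed
  have "card H * card ?P = card (\<Union>?P)"
  proof (rule card_partition)
    show "finite ?P" "finite (\<Union>?P)" unfolding U using C finite_sub by auto
    show "\<And>c. c \<in> ?P \<Longrightarrow> card c = card H" using card_l_coset Hc C by auto
    show "\<And>c d. c \<in> ?P \<Longrightarrow> d \<in> ?P \<Longrightarrow> c \<noteq> d \<Longrightarrow> c \<inter> d = {}"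
      using l_coset_disjoint[OF H] C by blast
  qed
  then show ?thesis unfolding U by (metis dvd_triv_left)
qed

section \<open>Kneser's addition theorem\<close>

definition kneser_bound :: "'a set \<Rightarrow> 'a set \<Rightarrow> bool" where
  "kneser_bound A B \<longleftrightarrow>
     card (A <#> stab (A <#> B)) + card (B <#> stab (A <#> B))
       \<le> card (A <#> B) + card (stab (A <#> B))"

text \<open>
  A set with period \<open>H1\<close> that misses \<open>x\<close> misses the whole coset of \<open>H1\<close> through \<open>x\<close>. So the
  intersection of \<open>P\<close> and \<open>Q\<close> misses the union of two cosets through \<open>x\<close>, and these overlap in a coset of
  \<open>H1 \<inter> H2\<close>.
\<close>

lemma card_missing_union:
  assumes H: "subgroup H G" and H1: "subgroup H1 G" "H1 \<subseteq> H" and H2: "subgroup H2 G" "H2 \<subseteq> H"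
    and P: "P \<subseteq> x <# H" "P <#> H1 = P" "x \<notin> P"
    and Q: "Q \<subseteq> x <# H" "Q <#> H2 = Q" "x \<notin> Q"
    and x: "x \<in> carrier G"
  shows "card (P \<inter> Q) + card H1 + card H2 \<le> card H + card (H1 \<inter> H2)"
proof -
  have cc: "H \<subseteq> carrier G" "H1 \<subseteq> carrier G" "H2 \<subseteq> carrier G"
    using subgroup.subset[OF H] subgroup.subset[OF H1(1)] subgroup.subset[OF H2(1)] .
  have sub: "x <# H \<subseteq> carrier G" using x cc by (simp add: l_coset_carrier)
  have miss: "R \<inter> (x <# L) = {}"
    if L: "subgroup L G" and R: "R \<subseteq> carrier G" "R <#> L = R" "x \<notin> R" for R L
  proof (rule ccontr)
    assume "R \<inter> (x <# L) \<noteq> {}"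
    then obtain y where y: "y \<in> R" "y \<in> x <# L" by auto
    have "x \<in> y <# L" using l_coset_mem_self[OF L x] l_coset_eqI[OF L x y(2)] by simp
    then have "x \<in> R <#> L" using y(1) by (auto simp: l_coset_def set_mult_def)
    then show False using R by simp
  qed
  have Pm: "P \<inter> (x <# H1) = {}" using miss[of H1 P] H1 P sub by auto
  have Qm: "Q \<inter> (x <# H2) = {}" using miss[of H2 Q] H2 Q sub by auto
  have x12: "x <# H1 \<subseteq> x <# H" "x <# H2 \<subseteq> x <# H" using H1 H2 by (auto simp: l_coset_def)
  have int: "(x <# H1) \<inter> (x <# H2) = x <# (H1 \<inter> H2)"
  proof
    show "(x <# H1) \<inter> (x <# H2) \<subseteq> x <# (H1 \<inter> H2)"
    proof
      fix y assume y: "y \<in> (x <# H1) \<inter> (x <# H2)"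
      then have yc: "y \<in> carrier G" using x12 sub by auto
      have "H1 \<inter> H2 \<subseteq> carrier G" using cc by auto
      then show "y \<in> x <# (H1 \<inter> H2)"
        using y in_l_coset_iff[OF x yc cc(2)] in_l_coset_iff[OF x yc cc(3)] in_l_coset_iff[OF x yc]
        by simp
    qed
    show "x <# (H1 \<inter> H2) \<subseteq> (x <# H1) \<inter> (x <# H2)" by (auto simp: l_coset_def)
  qed
  have fin: "finite (x <# H)" using sub by (rule finite_sub)
  then have f: "finite (x <# H1)" "finite (x <# H2)" "finite (P \<inter> Q)"
    using x12 P by (auto intro: finite_subset)
  have "card ((P \<inter> Q) \<union> ((x <# H1) \<union> (x <# H2))) \<le> card (x <# H)"
    using P Q x12 by (intro card_mono fin) auto
  moreover have "card ((P \<inter> Q) \<union> ((x <# H1) \<union> (x <# H2))) = card (P \<inter> Q) + card ((x <# H1) \<union> (x <# H2))"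
    using Pm Qm f by (intro card_Un_disjoint) auto
  moreover have "card ((x <# H1) \<union> (x <# H2)) + card (x <# (H1 \<inter> H2)) = card (x <# H1) + card (x <# H2)"
    using card_Un_Int[OF f(1,2)] unfolding int by simp
  moreover have "card (x <# H) = card H" "card (x <# H1) = card H1" "card (x <# H2) = card H2"
      "card (x <# (H1 \<inter> H2)) = card (H1 \<inter> H2)"
    using x cc by (auto intro!: card_l_coset)
  ultimately show ?thesis by linarith
qed

text \<open>
  Multiplication by an element of \<open>H\<close> does not leave a coset of \<open>H\<close>, so the part of \<open>X J\<close> in a coset comes
  from the part of \<open>X\<close> in the same coset.
\<close>

lemma l_coset_part_subset:
  assumes H: "subgroup H G" and J: "subgroup J G" "J \<subseteq> H"
    and X: "X \<subseteq> carrier G" and s: "s \<in> carrier G"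
  shows "(X <#> J) \<inter> (s <# H) \<subseteq> (X \<inter> (s <# H)) <#> J"
proof
  fix y assume y: "y \<in> (X <#> J) \<inter> (s <# H)"
  then obtain u j where u: "u \<in> X" "j \<in> J" "y = u \<otimes> j" by (auto simp: in_set_mult_iff)
  have uc: "u \<in> carrier G" using u X by auto
  have "y \<in> u <# H" using u J by (auto simp: l_coset_def)
  then have "y <# H = u <# H" using l_coset_eqI[OF H uc] by simp
  moreover have "y <# H = s <# H" using y l_coset_eqI[OF H s] by simp
  ultimately have "u \<in> s <# H" using l_coset_mem_self[OF H uc] by simp
  then show "y \<in> (X \<inter> (s <# H)) <#> J" using u by (auto intro: set_multI)
qed

lemma card_Un_le_3: "card (X \<union> (Y \<union> Z)) \<le> card X + card Y + card Z"
  using card_Un_le[of X "Y \<union> Z"] card_Un_le[of Y Z] by linarith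

text \<open>
  A convergent certifies a lower bound for \<open>|A B|\<close>. If \<open>H\<close> is a period of \<open>A\<close> and of \<open>B\<close>, the inequality
  reads \<open>|A| + |B| \<le> |C| + |H|\<close> and implies Kneser's bound. \<open>H\<close> need only be some period of \<open>C\<close>, not its
  full stabilizer, so that when \<open>C\<close> is enlarged only a period of the larger set has to be exhibited.
\<close>

definition convergent :: "'a set \<Rightarrow> 'a set \<Rightarrow> 'a set \<Rightarrow> 'a set \<Rightarrow> bool" where
  "convergent A B C H \<longleftrightarrow> C \<subseteq> A <#> B \<and> C \<noteq> {} \<and> subgroup H G \<and> C <#> H = C \<and>
     card (A \<inter> B) + card ((A \<union> B) <#> H) \<le> card C + card H"

lemma set_mult_Un_left: "(A \<union> B) <#> C = (A <#> C) \<union> (B <#> C)"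
  by (auto simp: set_mult_def)

lemma set_mult_Un_right: "A <#> (B \<union> C) = (A <#> B) \<union> (A <#> C)"
  by (auto simp: set_mult_def)

lemma set_mult_empty [simp]: "{} <#> A = {}" "A <#> {} = {}"
  by (auto simp: set_mult_def)

lemma set_mult_eq_empty_iff: "A <#> B = {} \<longleftrightarrow> A = {} \<or> B = {}"
  by (auto simp: set_mult_def)

text \<open>
  A nonempty set inside one coset of \<open>H\<close> can only be stabilized by elements of \<open>H\<close>, as any other
  translation moves the coset away.
\<close>

lemma periodic_sub_coset:
  assumes H: "subgroup H G" and J: "subgroup J G"
    and P: "P \<subseteq> x <# H" "P \<noteq> {}" "P <#> J = P" and x: "x \<in> carrier G"
  shows "J \<subseteq> H"
proof
  fix j assume j: "j \<in> J"
  have cc: "H \<subseteq> carrier G" "J \<subseteq> carrier G" using H J subgroup.subset by auto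
  obtain p where p: "p \<in> P" using P by auto
  have pc: "p \<in> carrier G" using p P l_coset_carrier[OF x cc(1)] by auto
  have "p \<otimes> j \<in> x <# H" using set_multI[OF p j] P by auto
  also have "x <# H = p <# H" using l_coset_eqI[OF H x, of p] p P by auto
  finally have "inv p \<otimes> (p \<otimes> j) \<in> H" using in_l_coset_iff[OF pc _ cc(1)] pc j cc by auto
  then show "j \<in> H" using pc j cc by (auto simp: subset_iff simp flip: m_assoc)
qed

text \<open>
  Suppose that the period \<open>H\<close> of a minimal convergent does not stabilize \<open>A B\<close>. Then some coset
  \<open>x H\<close> contains an element \<open>a b\<close> with \<open>a \<in> A\<close>, \<open>b \<in> B\<close>, but is not contained in \<open>A B\<close>; let \<open>x\<close> be a
  missing element. The coset is disjoint from \<open>C\<close>, and the parts of \<open>A\<close> and \<open>B\<close> in \<open>S = a H\<close> and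
  \<open>T = b H\<close> yield two subsets of it that can be added to \<open>C\<close>: \<open>P = (A \<inter> S) (B \<inter> T)\<close> and
  \<open>Q = (A \<inter> T) (B \<inter> S)\<close>. The sets \<open>C \<union> P\<close> and \<open>C \<union> P \<union> Q\<close> have smaller periods than \<open>H\<close>, so by minimality
  they are not convergents, which says that they are small. But Kneser's bound for \<open>P\<close> and \<open>Q\<close>,
  available by induction, says that \<open>P\<close> and \<open>Q\<close> are large, while \<open>P \<inter> Q\<close> is limited by
  \<open>card_missing_union\<close>. These facts are incompatible.
\<close>

lemma convergent_descent:
  assumes A: "A \<subseteq> carrier G" and B: "B \<subseteq> carrier G"
    and conv: "convergent A B C H"
    and min: "\<And>C' H'. convergent A B C' H' \<Longrightarrow> card H \<le> card H'"
    and IH: "\<And>A' B'. A' \<subseteq> A \<Longrightarrow> B' \<subseteq> B \<Longrightarrow> A' \<noteq> {} \<Longrightarrow> B' \<noteq> {} \<Longrightarrow>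
               card (A' <#> B') < card (A <#> B) \<Longrightarrow> kneser_bound A' B'"
  shows "(A <#> B) <#> H = A <#> B"
proof (rule ccontr)
  assume ne: "(A <#> B) <#> H \<noteq> A <#> B"
  have AB: "A <#> B \<subseteq> carrier G" using A B by (simp add: set_mult_closed)
  have H: "subgroup H G" and C: "C \<subseteq> A <#> B" "C \<noteq> {}" "C <#> H = C"
    and cineq: "card (A \<inter> B) + card ((A \<union> B) <#> H) \<le> card C + card H"
    using conv by (auto simp: convergent_def)
  have Hc: "H \<subseteq> carrier G" using H subgroup.subset by auto
  have finH: "finite H" using Hc by (rule finite_sub)
  obtain x where x: "x \<in> (A <#> B) <#> H" "x \<notin> A <#> B"
    using ne superset_set_mult_subgroup[OF H AB] by auto
  then obtain a b h where ab: "a \<in> A" "b \<in> B" "h \<in> H" "x = (a \<otimes> b) \<otimes> h"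
    by (auto simp: in_set_mult_iff)
  have ac: "a \<in> carrier G" and bc: "b \<in> carrier G" using ab A B by auto
  have xc: "x \<in> carrier G" using ab ac bc Hc by auto
  have "x \<in> (a \<otimes> b) <# H" using ab by (auto simp: l_coset_def)
  then have W: "(a \<otimes> b) <# H = x <# H" using l_coset_eqI[OF H, of "a \<otimes> b"] ac bc by simp
  define S T where "S = a <# H" and "T = b <# H"
  have ST: "S \<subseteq> carrier G" "T \<subseteq> carrier G" using ac bc Hc by (auto simp: S_def T_def l_coset_carrier)
  have cardST: "card S = card H" "card T = card H" using ac bc Hc by (auto simp: S_def T_def card_l_coset)
  have ST_prod: "S <#> T = x <# H"
  proof -
    have "S <#> T = ({a} <#> H) <#> ({b} <#> H)" by (simp add: S_def T_def l_coset_eq_set_mult)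
    also have "\<dots> = {a} <#> ((H <#> {b}) <#> H)" using ac bc Hc by (simp add: set_mult_assoc set_mult_closed)
    also have "\<dots> = {a} <#> (({b} <#> H) <#> H)" using bc Hc set_mult_comm[of H "{b}"] by simp
    also have "\<dots> = ({a} <#> {b}) <#> (H <#> H)" using ac bc Hc by (simp add: set_mult_assoc set_mult_closed)
    also have "\<dots> = {a \<otimes> b} <#> H" using subgroup_mult_id[OF H] by (simp add: set_mult_def)
    finally show ?thesis using W by (simp add: l_coset_eq_set_mult)
  qed
  define A1 A2 B1 B2 where "A1 = A \<inter> S" and "A2 = A \<inter> T" and "B1 = B \<inter> T" and "B2 = B \<inter> S"
  have parts: "A1 \<subseteq> carrier G" "A2 \<subseteq> carrier G" "B1 \<subseteq> carrier G" "B2 \<subseteq> carrier G"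
    using A B by (auto simp: A1_def A2_def B1_def B2_def)
  have mem: "a \<in> A1" "b \<in> B1" using ab l_coset_mem_self[OF H ac] l_coset_mem_self[OF H bc]
    by (auto simp: A1_def B1_def S_def T_def)
  define P Q where "P = A1 <#> B1" and "Q = A2 <#> B2"
  have PQ_AB: "P \<subseteq> A <#> B" "Q \<subseteq> A <#> B"
    unfolding P_def Q_def A1_def A2_def B1_def B2_def by (intro mono_set_mult; blast)+
  have PW: "P \<subseteq> x <# H"
    unfolding ST_prod[symmetric] P_def A1_def B1_def by (intro mono_set_mult) auto
  have "Q \<subseteq> T <#> S" unfolding Q_def A2_def B2_def by (intro mono_set_mult) auto
  then have QW: "Q \<subseteq> x <# H" using set_mult_comm[OF ST] ST_prod by simp
  have xPQ: "x \<notin> P" "x \<notin> Q" using x(2) PQ_AB by auto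
  have Pc: "P \<subseteq> carrier G" "Q \<subseteq> carrier G" using PQ_AB AB by auto
  have xself: "x \<in> x <# H" by (rule l_coset_mem_self[OF H xc])
  \<comment> \<open>Otherwise the period \<open>H\<close> of \<open>C\<close> would put \<open>x\<close> into \<open>C\<close>.\<close>
  have disjC: "C \<inter> (x <# H) = {}"
  proof (rule ccontr)
    assume "C \<inter> (x <# H) \<noteq> {}"
    then obtain y where y: "y \<in> C" "y \<in> x <# H" by auto
    then have "x \<in> y <# H" using l_coset_eqI[OF H xc y(2)] xself by simp
    then have "x \<in> C <#> H" using y(1) by (auto simp: l_coset_def set_mult_def)
    then show False using C x(2) by auto
  qed
  have finAB: "finite (A <#> B)" using AB by (rule finite_sub)
  then have finC: "finite C" using C finite_subset by auto
  have finP: "finite P" "finite Q" using Pc finite_sub by auto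
  have small: "card R < card (A <#> B)" if "R \<subseteq> A <#> B" "R \<subseteq> x <# H" for R
  proof -
    have "R \<subset> A <#> B" using that C disjC by blast
    then show ?thesis using finAB by (rule psubset_card_mono[rotated])
  qed
  have Cper: "C <#> J = C" if J: "subgroup J G" "J \<subseteq> H" for J
  proof
    have Cc: "C \<subseteq> carrier G" using C AB by auto
    show "C <#> J \<subseteq> C" using set_mult_subgroup_mono[OF H J Cc] C by simp
    show "C \<subseteq> C <#> J" using superset_set_mult_subgroup[OF J(1) Cc] .
  qed
  \<comment> \<open>Minimality of \<open>H\<close>: adding to \<open>C\<close> a set \<open>R\<close> in the coset with a smaller period gives no convergent.\<close>
  have nonconv: "card C + card R + card J < card (A \<inter> B) + card ((A \<union> B) <#> J)"
    if J: "subgroup J G" "J \<subseteq> H" "J \<noteq> H" and R: "R \<subseteq> A <#> B" "R \<subseteq> x <# H" "R <#> J = R" for J R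
  proof -
    have "card J < card H" using J finH by (intro psubset_card_mono) auto
    then have "\<not> convergent A B (C \<union> R) J" using min by fastforce
    moreover have "(C \<union> R) <#> J = C \<union> R" using Cper J R by (simp add: set_mult_Un_left)
    moreover have "card (C \<union> R) = card C + card R"
      using disjC R finC finAB finite_subset[OF R(1)] by (intro card_Un_disjoint) auto
    ultimately show ?thesis using C R J by (auto simp: convergent_def)
  qed
  define H1 H2 where "H1 = stab P" and "H2 = stab Q"
  have H1: "subgroup H1 G" "P <#> H1 = P" using Pc by (auto simp: H1_def subgroup_stab set_mult_stab)
  have H2: "subgroup H2 G" "Q <#> H2 = Q" using Pc by (auto simp: H2_def subgroup_stab set_mult_stab)
  have Pne: "P \<noteq> {}" using mem by (auto simp: P_def set_mult_def)
  have proper: "J \<noteq> H" if "R \<subseteq> x <# H" "R <#> J = R" "x \<notin> R" "R \<noteq> {}" for R J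
  proof
    assume "J = H"
    obtain r where r: "r \<in> R" using \<open>R \<noteq> {}\<close> by blast
    then have rx: "r \<in> x <# H" by (rule subsetD[OF that(1)])
    have "x \<in> r <# H" unfolding l_coset_eqI[OF H xc rx] by (rule xself)
    then have "x \<in> R <#> J" unfolding \<open>J = H\<close> using r by (auto simp: l_coset_def set_mult_def)
    then show False unfolding that(2) using that(3) by contradiction
  qed
  have H1H: "H1 \<subseteq> H" "H1 \<noteq> H"
    using periodic_sub_coset[OF H H1(1) PW Pne H1(2) xc] proper[OF PW H1(2) xPQ(1) Pne] by auto
  have ih1: "card (A1 <#> H1) + card (B1 <#> H1) \<le> card P + card H1"
  proof -
    have "kneser_bound A1 B1"
      using small[OF PQ_AB(1) PW] mem unfolding P_def by (intro IH) (auto simp: A1_def B1_def)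
    then show ?thesis by (simp add: kneser_bound_def P_def H1_def)
  qed
  have nc1: "card C + card P + card H1 < card (A \<inter> B) + card ((A \<union> B) <#> H1)"
    by (rule nonconv[OF H1(1) H1H PQ_AB(1) PW H1(2)])
  define E where "E = (A \<union> B) <#> H"
  have uc: "A \<union> B \<subseteq> carrier G" using A B by auto
  have Ec: "E \<subseteq> carrier G" using uc Hc by (simp add: E_def set_mult_closed)
  have finE: "finite E" using Ec by (rule finite_sub)
  have STE: "S \<subseteq> E" "T \<subseteq> E" using ab by (auto simp: S_def T_def E_def l_coset_def set_mult_def)
  have FE: "(A \<union> B) <#> J \<subseteq> E" if "subgroup J G" "J \<subseteq> H" for J
    using set_mult_subgroup_mono[OF H that uc] by (simp add: E_def)
  have FS: "S \<subseteq> (S - ((A \<union> B) <#> J)) \<union> ((A1 <#> J) \<union> (B2 <#> J))" if J: "subgroup J G" "J \<subseteq> H" for J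
    using l_coset_part_subset[OF H J uc ac] unfolding A1_def B2_def S_def set_mult_Un_left
    by (auto simp: Int_Un_distrib2 set_mult_Un_left)
  have FT: "T \<subseteq> (T - ((A \<union> B) <#> J)) \<union> ((A2 <#> J) \<union> (B1 <#> J))" if J: "subgroup J G" "J \<subseteq> H" for J
    using l_coset_part_subset[OF H J uc bc] unfolding A2_def B1_def T_def set_mult_Un_left
    by (auto simp: Int_Un_distrib2 set_mult_Un_left)
  have finJ: "finite (X <#> J)" if "X \<subseteq> carrier G" "subgroup J G" for X J
    using that by (intro finite_sub set_mult_closed) (auto simp: subgroup.subset)
  \<comment> \<open>If within \<open>S\<close> or \<open>T\<close> the set \<open>(A \<union> B) H1\<close> is covered by \<open>A1 H1\<close> and \<open>B1 H1\<close>, then \<open>C \<union> P\<close> is already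
    large enough to be a convergent. This excludes \<open>S = T\<close> and forces \<open>A2\<close> and \<open>B2\<close> to be nonempty.\<close>
  have one: False if R: "R \<subseteq> E" "card R = card H" "R \<subseteq> (R - ((A \<union> B) <#> H1)) \<union> ((A1 <#> H1) \<union> (B1 <#> H1))" for R
  proof -
    let ?F = "(A \<union> B) <#> H1"
    have fR: "finite R" using R finE finite_subset by auto
    have "card ?F + card (R - ?F) = card (?F \<union> (R - ?F))"
      using fR finJ[OF uc H1(1)] by (subst card_Un_disjoint) auto
    also have "\<dots> \<le> card E" using FE[OF H1(1) H1H(1)] R by (intro card_mono finE) auto
    finally have 1: "card ?F + card (R - ?F) \<le> card E" .
    have "card R \<le> card ((R - ?F) \<union> ((A1 <#> H1) \<union> (B1 <#> H1)))"
      using fR finJ[OF parts(1) H1(1)] finJ[OF parts(3) H1(1)] by (intro card_mono R) auto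
    also have "\<dots> \<le> card (R - ?F) + card (A1 <#> H1) + card (B1 <#> H1)"
      by (rule card_Un_le_3)
    finally show False using 1 nc1 ih1 cineq R(2) unfolding E_def by linarith
  qed
  have "S \<noteq> T"
  proof
    assume "S = T"
    then have "B2 = B1" by (simp add: B1_def B2_def)
    then show False using one[OF STE(1) cardST(1)] FS[OF H1(1) H1H(1)] by simp
  qed
  have "B2 \<noteq> {}"
  proof
    assume "B2 = {}"
    then show False using one[OF STE(1) cardST(1)] FS[OF H1(1) H1H(1)] by auto
  qed
  have "A2 \<noteq> {}"
  proof
    assume "A2 = {}"
    then show False using one[OF STE(2) cardST(2)] FT[OF H1(1) H1H(1)] by auto
  qed
  have Qne: "Q \<noteq> {}" using \<open>A2 \<noteq> {}\<close> \<open>B2 \<noteq> {}\<close> by (simp add: Q_def set_mult_eq_empty_iff)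
  have H2H: "H2 \<subseteq> H" using periodic_sub_coset[OF H H2(1) QW Qne H2(2) xc] .
  have ih2: "card (A2 <#> H2) + card (B2 <#> H2) \<le> card Q + card H2"
  proof -
    have "kneser_bound A2 B2"
      using small[OF PQ_AB(2) QW] \<open>A2 \<noteq> {}\<close> \<open>B2 \<noteq> {}\<close> unfolding Q_def by (intro IH) (auto simp: A2_def B2_def)
    then show ?thesis by (simp add: kneser_bound_def Q_def H2_def)
  qed
  define J where "J = H1 \<inter> H2"
  have J: "subgroup J G" "J \<subseteq> H" "J \<noteq> H" "J \<subseteq> H1" "J \<subseteq> H2"
    using H1 H2 H1H by (auto simp: J_def subgroups_Inter_pair)
  have PQJ: "(P \<union> Q) <#> J = P \<union> Q"
  proof -
    have "P <#> J = P"
      using set_mult_subgroup_mono[OF H1(1) J(1) J(4) Pc(1)] superset_set_mult_subgroup[OF J(1) Pc(1)] H1(2) by auto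
    moreover have "Q <#> J = Q"
      using set_mult_subgroup_mono[OF H2(1) J(1) J(5) Pc(2)] superset_set_mult_subgroup[OF J(1) Pc(2)] H2(2) by auto
    ultimately show ?thesis by (simp add: set_mult_Un_left)
  qed
  let ?F = "(A \<union> B) <#> J"
  \<comment> \<open>The intersection of the two periods is the period to use for \<open>C \<union> P \<union> Q\<close>; it may be
    smaller than the stabilizer.\<close>
  have nc3: "card C + card (P \<union> Q) + card J < card (A \<inter> B) + card ?F"
    using PQ_AB PW QW PQJ by (intro nonconv J) auto
  have fS: "finite S" "finite T" using ST finite_sub by auto
  have "S \<inter> T = {}"
    using \<open>S \<noteq> T\<close> l_coset_disjoint[OF H ac bc] by (simp add: S_def T_def)
  then have "card ?F + (card (S - ?F) + card (T - ?F)) = card (?F \<union> ((S - ?F) \<union> (T - ?F)))"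
    using fS finJ[OF uc J(1)] by (subst card_Un_disjoint; (subst card_Un_disjoint)?) auto
  also have "\<dots> \<le> card E" using FE[OF J(1,2)] STE by (intro card_mono finE) auto
  finally have 1: "card ?F + (card (S - ?F) + card (T - ?F)) \<le> card E" .
  have mono: "card (X <#> J) \<le> card (X <#> L)" if "X \<subseteq> carrier G" "subgroup L G" "J \<subseteq> L" for X L
    using set_mult_subgroup_mono[OF that(2) J(1) that(3,1)] finJ[OF that(1,2)] by (rule card_mono[rotated])
  have "card S \<le> card ((S - ?F) \<union> ((A1 <#> J) \<union> (B2 <#> J)))"
    using fS finJ J parts by (intro card_mono FS) auto
  also have "\<dots> \<le> card (S - ?F) + card (A1 <#> J) + card (B2 <#> J)"
    by (rule card_Un_le_3)
  finally have 2: "card H \<le> card (S - ?F) + card (A1 <#> H1) + card (B2 <#> H2)"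
    using mono[OF parts(1) H1(1) J(4)] mono[OF parts(4) H2(1) J(5)] cardST by linarith
  have "card T \<le> card ((T - ?F) \<union> ((A2 <#> J) \<union> (B1 <#> J)))"
    using fS finJ J parts by (intro card_mono FT) auto
  also have "\<dots> \<le> card (T - ?F) + card (A2 <#> J) + card (B1 <#> J)"
    by (rule card_Un_le_3)
  finally have 3: "card H \<le> card (T - ?F) + card (A2 <#> H2) + card (B1 <#> H1)"
    using mono[OF parts(2) H2(1) J(5)] mono[OF parts(3) H1(1) J(4)] cardST by linarith
  have 4: "card (P \<inter> Q) + card H1 + card H2 \<le> card H + card J"
    unfolding J_def by (rule card_missing_union[OF H H1(1) H1H(1) H2(1) H2H PW H1(2) xPQ(1) QW H2(2) xPQ(2) xc])
  have 5: "card (P \<union> Q) + card (P \<inter> Q) = card P + card Q"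
    using card_Un_Int[OF finP] by simp
  show False using 1 2 3 4 5 nc3 ih1 ih2 cineq unfolding E_def by linarith
qed

lemma set_mult_period_subset:
  assumes "subgroup H G" "subgroup J G" "J \<subseteq> H" "X \<subseteq> carrier G" "X <#> H = X"
  shows "X <#> J = X"
  using set_mult_subgroup_mono[OF assms(1-4)] superset_set_mult_subgroup[OF assms(2,4)] assms(5) by simp

lemma set_mult_l_coset_right:
  assumes "x \<in> carrier G" "A \<subseteq> carrier G" "B \<subseteq> carrier G"
  shows "A <#> (x <# B) = x <# (A <#> B)"
  using assms by (simp add: set_mult_comm[of A] l_coset_carrier set_mult_l_coset)

text \<open>
  The product of \<open>A \<inter> B\<close> and \<open>A \<union> B\<close> lies in \<open>A B\<close>. If it is smaller, or if it is all of \<open>A B\<close>, the induction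
  hypothesis applies to this pair: in the second case the stabilizer is the same, \<open>A \<inter> B\<close> is periodic
  like \<open>A\<close> and \<open>B\<close>, and it is a proper subset of \<open>A\<close>. So convergents exist. The period of a minimal one lies
  in the stabilizer of \<open>A B\<close>, so it is a period of \<open>A \<union> B\<close>, and the bound follows from
  \<open>|A \<inter> B| + |A \<union> B| = |A| + |B|\<close>.
\<close>

lemma kneser_periodic_step:
  assumes A: "A \<subseteq> carrier G" "A <#> stab (A <#> B) = A"
    and B: "B \<subseteq> carrier G" "B <#> stab (A <#> B) = B"
    and meet: "A \<inter> B \<noteq> {}" and nsub: "\<not> A \<subseteq> B"
    and IH: "\<And>A' B'. A' \<subseteq> carrier G \<Longrightarrow> B' \<subseteq> carrier G \<Longrightarrow> A' \<noteq> {} \<Longrightarrow> B' \<noteq> {} \<Longrightarrow>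
        card (A' <#> B') < card (A <#> B) \<or>
        card (A' <#> B') = card (A <#> B) \<and> card (A' <#> stab (A' <#> B')) < card A \<Longrightarrow>
        kneser_bound A' B'"
  shows "kneser_bound A B"
proof -
  define K where "K = stab (A <#> B)"
  have AB: "A <#> B \<subseteq> carrier G" using A B by (simp add: set_mult_closed)
  have finAB: "finite (A <#> B)" using AB by (rule finite_sub)
  have fin: "finite A" "finite B" using A B finite_sub by auto
  have K: "subgroup K G" by (simp add: K_def subgroup_stab)
  define C0 where "C0 = (A \<inter> B) <#> (A \<union> B)"
  have cI: "A \<inter> B \<subseteq> carrier G" and cU: "A \<union> B \<subseteq> carrier G" using A B by auto
  have C0: "C0 \<subseteq> A <#> B"
  proof -
    have "(A \<inter> B) <#> A \<subseteq> B <#> A" by (intro mono_set_mult) auto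
    moreover have "B <#> A = A <#> B" using A B by (simp add: set_mult_comm)
    moreover have "(A \<inter> B) <#> B \<subseteq> A <#> B" by (intro mono_set_mult) auto
    ultimately show ?thesis by (simp add: C0_def set_mult_Un_right)
  qed
  have "kneser_bound (A \<inter> B) (A \<union> B)"
  proof (rule IH[OF cI cU])
    show "A \<inter> B \<noteq> {}" "A \<union> B \<noteq> {}" using meet by auto
    show "card ((A \<inter> B) <#> (A \<union> B)) < card (A <#> B) \<or>
        card ((A \<inter> B) <#> (A \<union> B)) = card (A <#> B) \<and>
        card ((A \<inter> B) <#> stab ((A \<inter> B) <#> (A \<union> B))) < card A"
    proof (cases "C0 = A <#> B")
      case True
      have "(A \<inter> B) <#> K \<subseteq> A \<inter> B"
        using mono_set_mult[of "A \<inter> B" A K K G] mono_set_mult[of "A \<inter> B" B K K G] A B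
        by (auto simp: K_def)
      then have "card ((A \<inter> B) <#> K) \<le> card (A \<inter> B)" using fin by (intro card_mono) auto
      also have "\<dots> < card A" using nsub fin by (intro psubset_card_mono) auto
      finally show ?thesis using True by (simp add: C0_def K_def)
    next
      case False
      then have "card C0 < card (A <#> B)" using C0 finAB by (intro psubset_card_mono) auto
      then show ?thesis by (simp add: C0_def)
    qed
  qed
  moreover have "card (A \<inter> B) \<le> card ((A \<inter> B) <#> stab C0)"
    by (intro card_mono finite_sub superset_set_mult_subgroup subgroup_stab cI set_mult_closed stab_carrier)
  moreover have "C0 \<noteq> {}" using meet unfolding C0_def set_mult_eq_empty_iff by auto
  moreover have "C0 \<subseteq> carrier G" using C0 AB by auto
  ultimately have "convergent A B C0 (stab C0)"
    using C0 by (simp add: convergent_def kneser_bound_def subgroup_stab set_mult_stab flip: C0_def)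
  then have "\<exists>CH. (case CH of (C, H) \<Rightarrow> convergent A B C H)" by auto
  then obtain CH where CH: "case CH of (C, H) \<Rightarrow> convergent A B C H"
    and least: "\<And>CH'. (case CH' of (C, H) \<Rightarrow> convergent A B C H) \<Longrightarrow> card (snd CH) \<le> card (snd CH')"
    using ex_has_least_nat[of "\<lambda>CH. case CH of (C, H) \<Rightarrow> convergent A B C H" _ "\<lambda>CH. card (snd CH)"] by blast
  obtain C H where [simp]: "CH = (C, H)" by (cases CH)
  have conv: "convergent A B C H" using CH by simp
  have min: "card H \<le> card H'" if "convergent A B C' H'" for C' H' using least[of "(C', H')"] that by simp
  have H: "subgroup H G" and C: "C \<subseteq> A <#> B"
    and cineq: "card (A \<inter> B) + card ((A \<union> B) <#> H) \<le> card C + card H"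
    using conv by (auto simp: convergent_def)
  have "(A <#> B) <#> H = A <#> B"
    by (rule convergent_descent[OF A(1) B(1) conv min])
      (use A(1) B(1) in \<open>auto intro!: IH\<close>)
  then have HK: "H \<subseteq> K" unfolding K_def by (intro subset_stab H AB)
  have "(A \<union> B) <#> H = A \<union> B"
    using set_mult_period_subset[OF K H HK] A B by (simp add: set_mult_Un_left K_def)
  moreover have "card H \<le> card K" using HK K by (intro card_mono finite_sub) (auto simp: subgroup.subset)
  moreover have "card C \<le> card (A <#> B)" using C finAB by (intro card_mono) auto
  moreover have "card A + card B = card (A \<inter> B) + card (A \<union> B)" using card_Un_Int[OF fin] by simp
  ultimately show ?thesis using cineq A B by (simp add: kneser_bound_def K_def)
qed

text \<open>
  Replacing \<open>A\<close> and \<open>B\<close> by \<open>X = A K\<close> and \<open>Y = B K\<close> does not change the product or the bound. If \<open>X\<close>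
  is a single coset of \<open>K\<close>, the bound is trivial. Otherwise two elements of \<open>X\<close> differ by some \<open>g \<notin> K\<close>;
  then \<open>g\<close> does not stabilize \<open>Y\<close>, and so some translate of \<open>Y\<close> contains exactly one of the two elements.

  The induction is on \<open>|A B|\<close> and then on \<open>|A K|\<close> instead of \<open>|A|\<close>, so that passing from \<open>A\<close>
  to \<open>A K\<close> costs nothing.
\<close>

lemma kneser_step:
  assumes A: "A \<subseteq> carrier G" "A \<noteq> {}" and B: "B \<subseteq> carrier G" "B \<noteq> {}"
    and IH: "\<And>A' B'. A' \<subseteq> carrier G \<Longrightarrow> B' \<subseteq> carrier G \<Longrightarrow> A' \<noteq> {} \<Longrightarrow> B' \<noteq> {} \<Longrightarrow>
        card (A' <#> B') < card (A <#> B) \<or>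
        card (A' <#> B') = card (A <#> B) \<and>
        card (A' <#> stab (A' <#> B')) < card (A <#> stab (A <#> B)) \<Longrightarrow>
        kneser_bound A' B'"
  shows "kneser_bound A B"
proof -
  define K where "K = stab (A <#> B)"
  have K: "subgroup K G" by (simp add: K_def subgroup_stab)
  have Kc: "K \<subseteq> carrier G" by (simp add: K_def stab_carrier)
  have AB: "A <#> B \<subseteq> carrier G" using A B by (simp add: set_mult_closed)
  define X Y where "X = A <#> K" and "Y = B <#> K"
  have X: "X \<subseteq> carrier G" "X <#> K = X" and Y: "Y \<subseteq> carrier G" "Y <#> K = Y"
    using A B K Kc by (auto simp: X_def Y_def set_mult_closed set_mult_subgroup_idem)
  have ne: "X \<noteq> {}" "Y \<noteq> {}"
    using A B subgroup.one_closed[OF K] by (auto simp: X_def Y_def set_mult_eq_empty_iff)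
  have XY: "X <#> Y = A <#> B"
  proof -
    have "X <#> Y = A <#> ((K <#> B) <#> K)" using A B Kc by (simp add: X_def Y_def set_mult_assoc set_mult_closed)
    also have "\<dots> = A <#> ((B <#> K) <#> K)" using B Kc by (simp add: set_mult_comm[of K B])
    also have "\<dots> = (A <#> B) <#> K" using A B Kc K by (simp add: set_mult_assoc set_mult_closed subgroup_mult_id)
    also have "\<dots> = A <#> B" using AB by (simp add: K_def set_mult_stab)
    finally show ?thesis .
  qed
  have finXY: "finite (X <#> Y)" using XY AB finite_sub by simp
  have goal: "card X + card Y \<le> card (A <#> B) + card K"
  proof (cases "\<exists>a\<in>X. X \<subseteq> a <# K")
    case True
    then obtain a where a: "a \<in> X" "X \<subseteq> a <# K" by auto
    have ac: "a \<in> carrier G" using a X by auto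
    have "card X \<le> card (a <# K)" using a ac Kc by (intro card_mono finite_sub l_coset_carrier)
    also have "\<dots> = card K" using ac Kc by (rule card_l_coset)
    finally have "card X \<le> card K" .
    moreover have "a <# Y \<subseteq> X <#> Y" using a by (auto simp: l_coset_def set_mult_def)
    then have "card (a <# Y) \<le> card (X <#> Y)" by (rule card_mono[OF finXY])
    then have "card Y \<le> card (A <#> B)" using card_l_coset[OF ac Y(1)] XY by simp
    ultimately show ?thesis by simp
  next
    case False
    obtain a where a: "a \<in> X" using ne by auto
    then obtain a' where a': "a' \<in> X" "a' \<notin> a <# K" using False by auto
    have ac: "a \<in> carrier G" "a' \<in> carrier G" using a a' X by auto
    define g where "g = inv a \<otimes> a'"
    have gc: "g \<in> carrier G" using ac by (simp add: g_def)
    have ag: "a \<otimes> g = a'" using ac by (simp add: g_def flip: m_assoc)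
    have "g \<notin> K" using a'(2) in_l_coset_iff[OF ac Kc] by (simp add: g_def)
    moreover have "stab Y \<subseteq> K" using stab_set_mult_mono[OF X(1) Y(1)] XY by (simp add: K_def)
    ultimately have "g \<notin> stab Y" by auto
    then obtain b where b: "b \<in> carrier G" "(b \<otimes> g \<in> Y) \<noteq> (b \<in> Y)" using gc by (auto simp: stab_def)
    define t where "t = a \<otimes> inv b"
    have tc: "t \<in> carrier G" using ac b by (simp add: t_def)
    have tb: "t \<otimes> b = a" using ac b by (simp add: t_def m_assoc)
    have inv_tb: "inv t \<otimes> a = b" using tb tc b by (metis inv_solve_left ac(1))
    have "inv t \<otimes> a' = b \<otimes> g" using inv_tb ag ac tc gc by (metis inv_closed m_assoc)
    then have "(a \<in> t <# Y) \<noteq> (a' \<in> t <# Y)"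
      using in_l_coset_iff[OF tc ac(1) Y(1)] in_l_coset_iff[OF tc ac(2) Y(1)] inv_tb b by auto
    then have meet: "X \<inter> (t <# Y) \<noteq> {}" and nsub: "\<not> X \<subseteq> t <# Y" using a a' by auto
    have Z: "t <# Y \<subseteq> carrier G" using tc Y by (simp add: l_coset_carrier)
    have XZ: "X <#> (t <# Y) = t <# (X <#> Y)" using tc X Y by (simp add: set_mult_l_coset_right)
    have XYc: "X <#> Y \<subseteq> carrier G" using XY AB by simp
    have stabXZ: "stab (X <#> (t <# Y)) = K" using XZ stab_l_coset[OF tc XYc] XY by (simp add: K_def)
    have cardXZ: "card (X <#> (t <# Y)) = card (A <#> B)" using XZ card_l_coset[OF tc XYc] XY by simp
    have Zper: "(t <# Y) <#> K = t <# Y" using set_mult_l_coset[OF tc Y(1) Kc] Y by simp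
    have "kneser_bound X (t <# Y)"
    proof (rule kneser_periodic_step[OF X(1) _ Z _ meet nsub])
      show "X <#> stab (X <#> (t <# Y)) = X" "(t <# Y) <#> stab (X <#> (t <# Y)) = t <# Y"
        using stabXZ X Zper by auto
    next
      fix A' B'
      assume "A' \<subseteq> carrier G" "B' \<subseteq> carrier G" "A' \<noteq> {}" "B' \<noteq> {}"
        "card (A' <#> B') < card (X <#> (t <# Y)) \<or>
         card (A' <#> B') = card (X <#> (t <# Y)) \<and> card (A' <#> stab (A' <#> B')) < card X"
      then show "kneser_bound A' B'" by (intro IH) (simp_all add: cardXZ flip: X_def K_def)
    qed
    then show ?thesis unfolding kneser_bound_def stabXZ cardXZ X(2) Zper card_l_coset[OF tc Y(1)] .
  qed
  then show ?thesis by (simp add: kneser_bound_def X_def Y_def K_def)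
qed

theorem kneser_addition:
  assumes "A \<subseteq> carrier G" "A \<noteq> {}" "B \<subseteq> carrier G" "B \<noteq> {}"
  shows "card (A <#> stab (A <#> B)) + card (B <#> stab (A <#> B))
       \<le> card (A <#> B) + card (stab (A <#> B))"
proof -
  let ?f = "\<lambda>(A, B). card (A <#> B)" and ?g = "\<lambda>(A, B). card (A <#> stab (A <#> B))"
  have "A \<subseteq> carrier G \<longrightarrow> A \<noteq> {} \<longrightarrow> B \<subseteq> carrier G \<longrightarrow> B \<noteq> {} \<longrightarrow> kneser_bound A B" for A B
  proof (induction "(A, B)" arbitrary: A B rule: wf_induct_rule[OF wf_measures[of "[?f, ?g]"]])
    case 1
    show ?case
    proof (intro impI)
      assume "A \<subseteq> carrier G" "A \<noteq> {}" "B \<subseteq> carrier G" "B \<noteq> {}"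
      then show "kneser_bound A B" by (rule kneser_step) (use 1 in auto)
    qed
  qed
  then show ?thesis using assms by (auto simp: kneser_bound_def)
qed

section \<open>The upper bound\<close>

definition sumset :: "'a set list \<Rightarrow> 'a set" where
  "sumset As = foldr (\<lambda>A S. A <#> S) As {\<one>}"

lemma sumset_simps [simp]: "sumset [] = {\<one>}" "sumset (A # As) = A <#> sumset As"
  by (simp_all add: sumset_def)

lemma sumset_carrier: "\<forall>A\<in>set As. A \<subseteq> carrier G \<Longrightarrow> sumset As \<subseteq> carrier G"
  by (induction As) (auto simp: set_mult_closed)

lemma sumset_nonempty: "\<forall>A\<in>set As. A \<noteq> {} \<Longrightarrow> sumset As \<noteq> {}"
  by (induction As) (auto simp: set_mult_eq_empty_iff)

lemma sumset_append:
  assumes "\<forall>A\<in>set As. A \<subseteq> carrier G" "\<forall>A\<in>set Bs. A \<subseteq> carrier G"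
  shows "sumset (As @ Bs) = sumset As <#> sumset Bs"
  using assms
proof (induction As)
  case Nil
  then have "sumset Bs \<subseteq> carrier G" by (simp add: sumset_carrier)
  then show ?case by (simp add: lcos_mult_one flip: l_coset_eq_set_mult)
next
  case (Cons A As)
  then show ?case by (simp add: set_mult_assoc sumset_carrier)
qed

text \<open>
  Fixing the subgroup \<open>K\<close> in advance makes the induction work: the stabilizer of a
  product of fewer factors can only be smaller, so \<open>K\<close> is also the stabilizer of each shorter
  product once this product is multiplied by \<open>K\<close>.
\<close>

lemma kneser_sumset:
  assumes "\<forall>A\<in>set As. A \<subseteq> carrier G \<and> A \<noteq> {}"
    and "subgroup K G" "stab (sumset As <#> K) = K"
  shows "(\<Sum>A\<leftarrow>As. card (A <#> K)) + card K \<le> card (sumset As <#> K) + length As * card K"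
  using assms
proof (induction As)
  case Nil
  have "{\<one>} <#> K = K" using lcos_mult_one[OF subgroup.subset[OF \<open>subgroup K G\<close>]]
    by (simp add: l_coset_eq_set_mult)
  then show ?case by simp
next
  case (Cons A As)
  define S where "S = sumset As"
  have K: "subgroup K G" "K \<subseteq> carrier G" using Cons.prems subgroup.subset by auto
  have A: "A \<subseteq> carrier G" "A \<noteq> {}" and S: "S \<subseteq> carrier G" "S \<noteq> {}"
    using Cons.prems by (auto simp: S_def sumset_carrier sumset_nonempty)
  have SK: "S <#> K \<subseteq> carrier G" "A <#> K \<subseteq> carrier G" using A S K by (auto simp: set_mult_closed)
  have ASK: "(A <#> K) <#> (S <#> K) = (A <#> S) <#> K"
  proof -
    have "(A <#> K) <#> (S <#> K) = A <#> ((K <#> S) <#> K)" using A S K by (simp add: set_mult_assoc set_mult_closed)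
    also have "\<dots> = A <#> ((S <#> K) <#> K)" using S K by (simp add: set_mult_comm[of K S])
    also have "\<dots> = (A <#> S) <#> K" using A S K by (simp add: set_mult_assoc set_mult_closed subgroup_mult_id)
    finally show ?thesis .
  qed
  have st: "stab ((A <#> K) <#> (S <#> K)) = K" using Cons.prems ASK by (simp add: S_def)
  have "stab (S <#> K) \<subseteq> K" using stab_set_mult_mono[OF SK(2,1)] st by simp
  moreover have "K \<subseteq> stab (S <#> K)"
    by (intro subset_stab K SK set_mult_subgroup_idem S)
  ultimately have "stab (S <#> K) = K" by auto
  then have IH: "(\<Sum>A\<leftarrow>As. card (A <#> K)) + card K \<le> card (S <#> K) + length As * card K"
    using Cons.IH Cons.prems K by (simp add: S_def)
  have one: "\<one> \<in> K" by (rule subgroup.one_closed[OF K(1)])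
  have ne: "A <#> K \<noteq> {}" "S <#> K \<noteq> {}" using A(2) S(2) one unfolding set_mult_eq_empty_iff by auto
  have "card ((A <#> K) <#> K) + card ((S <#> K) <#> K) \<le> card ((A <#> S) <#> K) + card K"
    using kneser_addition[OF SK(2) ne(1) SK(1) ne(2)] unfolding st unfolding ASK .
  then have "card (A <#> K) + card (S <#> K) \<le> card ((A <#> S) <#> K) + card K"
    using K A S by (simp add: set_mult_subgroup_idem)
  then show ?case using IH by (simp add: S_def)
qed

lemma hfold_sumset_0: "hfold_sumset G 0 A = {\<one>}"
  by (auto simp: hfold_sumset_def)

lemma hfold_sumset_Suc:
  assumes "A \<subseteq> carrier G"
  shows "hfold_sumset G (Suc h) A = A <#> hfold_sumset G h A"
proof -
  have split: "finprod G a {..<Suc h} = a h \<otimes> finprod G a {..<h}" if "a \<in> {..<Suc h} \<rightarrow> A" for a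
  proof -
    have "a \<in> {..<h} \<rightarrow> carrier G" "a h \<in> carrier G" using that assms by auto
    then show ?thesis by (simp add: lessThan_Suc)
  qed
  show ?thesis
  proof
    show "hfold_sumset G (Suc h) A \<subseteq> A <#> hfold_sumset G h A"
    proof
      fix x assume "x \<in> hfold_sumset G (Suc h) A"
      then obtain a where a: "x = finprod G a {..<Suc h}" "a \<in> {..<Suc h} \<rightarrow> A"
        by (auto simp: hfold_sumset_def)
      have "a \<in> {..<h} \<rightarrow> A" using a(2) by auto
      then have "finprod G a {..<h} \<in> hfold_sumset G h A" unfolding hfold_sumset_def by blast
      moreover have "a h \<in> A" using a(2) by auto
      ultimately show "x \<in> A <#> hfold_sumset G h A" unfolding a(1) split[OF a(2)]
        by (intro set_multI)
    qed
    show "A <#> hfold_sumset G h A \<subseteq> hfold_sumset G (Suc h) A"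
    proof
      fix x assume "x \<in> A <#> hfold_sumset G h A"
      then obtain y a where y: "y \<in> A" "x = y \<otimes> finprod G a {..<h}" "a \<in> {..<h} \<rightarrow> A"
        by (auto simp: in_set_mult_iff hfold_sumset_def)
      let ?b = "a(h := y)"
      have b: "?b \<in> {..<Suc h} \<rightarrow> A" using y by (auto simp: less_Suc_eq)
      have "finprod G ?b {..<h} = finprod G a {..<h}"
        using y(3) assms by (intro finprod_cong') auto
      then have "x = finprod G ?b {..<Suc h}" unfolding split[OF b] using y(2) by simp
      then show "x \<in> hfold_sumset G (Suc h) A" using b by (auto simp: hfold_sumset_def)
    qed
  qed
qed

lemma hfold_sumset_eq_sumset:
  "A \<subseteq> carrier G \<Longrightarrow> hfold_sumset G h A = sumset (replicate h A)"
  by (induction h) (simp_all add: hfold_sumset_0 hfold_sumset_Suc)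

lemma inv_image_set_mult:
  assumes "A \<subseteq> carrier G" "B \<subseteq> carrier G"
  shows "m_inv G ` (A <#> B) = (m_inv G ` A) <#> (m_inv G ` B)"
proof -
  have "inv (a \<otimes> b) = inv a \<otimes> inv b" if "a \<in> A" "b \<in> B" for a b
    using assms that by (intro inv_mult) auto
  then show ?thesis by (force simp: set_mult_def)
qed

lemma inv_image_carrier: "A \<subseteq> carrier G \<Longrightarrow> m_inv G ` A \<subseteq> carrier G"
  by auto

lemma inv_image_subgroup:
  assumes "subgroup H G"
  shows "m_inv G ` H = H"
proof
  show "m_inv G ` H \<subseteq> H" using assms subgroup.m_inv_closed by auto
  show "H \<subseteq> m_inv G ` H"
  proof
    fix h assume h: "h \<in> H"
    then have "inv h \<in> H" "h = inv (inv h)" using assms by (auto simp: subgroup.m_inv_closed subgroup.mem_carrier)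
    then show "h \<in> m_inv G ` H" by blast
  qed
qed

lemma sumset_replicate_inv:
  assumes "A \<subseteq> carrier G"
  shows "sumset (replicate h (m_inv G ` A)) = m_inv G ` sumset (replicate h A)"
proof (induction h)
  case (Suc h)
  have "sumset (replicate h A) \<subseteq> carrier G" using assms by (intro sumset_carrier) auto
  then show ?case using Suc assms by (simp add: inv_image_set_mult)
qed simp

lemma one_notin_sumset:
  assumes "sum_free G k l A"
  shows "\<one> \<notin> sumset (replicate k A @ replicate l (m_inv G ` A))"
proof
  have A: "A \<subseteq> carrier G" using assms by (simp add: sum_free_def)
  let ?k = "sumset (replicate k A)" and ?l = "sumset (replicate l A)"
  have kl: "?k \<subseteq> carrier G" "?l \<subseteq> carrier G" using A by (auto intro!: sumset_carrier)
  assume "\<one> \<in> sumset (replicate k A @ replicate l (m_inv G ` A))"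
  also have "sumset (replicate k A @ replicate l (m_inv G ` A)) = ?k <#> (m_inv G ` ?l)"
    using A inv_image_carrier[OF A] by (subst sumset_append) (auto simp: sumset_replicate_inv)
  finally obtain x y where xy: "x \<in> ?k" "y \<in> ?l" "\<one> = x \<otimes> inv y"
    by (auto simp: in_set_mult_iff)
  then have "x = y" using kl by (metis inv_closed inv_equality inv_inv subsetD)
  then show False using xy assms A by (auto simp: sum_free_def hfold_sumset_eq_sumset)
qed

lemma sum_free_card_le:
  assumes sf: "sum_free G k l A" and pos: "k + l > 0"
  shows "\<exists>d. d dvd order G \<and>
    int (card A) \<le> (\<lfloor>(real d - 2) / real (k + l)\<rfloor> + 1) * int (order G div d)"
proof (cases "A = {}")
  case True
  have "real (k + l) \<ge> 1" using pos by linarith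
  then have "0 < 1 / real (k + l)" "1 / real (k + l) \<le> 1" by (auto simp only: zero_less_divide_iff divide_le_eq_1)
  then have "\<lfloor>(real 1 - 2) / real (k + l)\<rfloor> = - 1"
    by (simp add: floor_eq_iff)
  then show ?thesis using True by (intro exI[of _ 1]) simp
next
  case False
  have A: "A \<subseteq> carrier G" using sf by (simp add: sum_free_def)
  define As where "As = replicate k A @ replicate l (m_inv G ` A)"
  define S where "S = sumset As"
  define K where "K = stab S"
  have As: "\<forall>X\<in>set As. X \<subseteq> carrier G \<and> X \<noteq> {}"
    using A False inv_image_carrier[OF A] by (auto simp: As_def)
  have S: "S \<subseteq> carrier G" using As by (simp add: S_def sumset_carrier)
  have K: "subgroup K G" "K \<subseteq> carrier G" by (simp_all add: K_def subgroup_stab stab_carrier)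
  have SK: "S <#> K = S" using S by (simp add: K_def set_mult_stab)
  \<comment> \<open>The divisor whose term bounds \<open>|A|\<close> is the index of the stabilizer.\<close>
  define d where "d = card (rcosets K)"
  have n: "order G = d * card K" using lagrange[OF K(1)] by (simp add: d_def)
  have finK: "finite K" using K(2) by (rule finite_sub)
  have Kpos: "card K > 0" using subgroup.one_closed[OF K(1)] finK card_gt_0_iff by blast
  have npos: "order G > 0" by (simp add: order_gt_0_iff_finite finite_carrier)
  then have dpos: "d > 0" using n by (metis mult_0 neq0_conv)
  have "card K dvd card (A <#> K)"
    using K A by (intro period_dvd_card) (auto simp: set_mult_closed set_mult_subgroup_idem)
  then obtain m where m: "card (A <#> K) = m * card K" by (auto simp: dvd_def mult.commute)
  have invAK: "card ((m_inv G ` A) <#> K) = m * card K"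
  proof -
    have AK: "A <#> K \<subseteq> carrier G" using A K by (simp add: set_mult_closed)
    have "(m_inv G ` A) <#> K = m_inv G ` (A <#> K)"
      using inv_image_set_mult[OF A K(2)] inv_image_subgroup[OF K(1)] by simp
    also have "card \<dots> = card (A <#> K)"
      using AK by (intro card_image) (auto intro!: inj_onI dest: subsetD inv_inj[THEN inj_onD])
    finally show ?thesis using m by simp
  qed
  have "stab (sumset As <#> K) = K" using SK by (simp add: S_def K_def)
  from kneser_sumset[OF As K(1) this]
  have kn: "(k + l) * (m * card K) + card K \<le> card S + (k + l) * card K"
    using SK m invAK by (simp add: S_def As_def sum_list_replicate add_mult_distrib)
  have "S \<inter> K = {}"
  proof (rule ccontr)
    assume "S \<inter> K \<noteq> {}"
    then obtain g where g: "g \<in> S" "g \<in> K" by auto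
    then have "g \<otimes> inv g \<in> S <#> K" by (intro set_multI subgroup.m_inv_closed[OF K(1)])
    then show False using SK g K one_notin_sumset[OF sf] by (auto simp: S_def As_def subset_iff)
  qed
  then have "card S + card K = card (S \<union> K)"
    using finite_sub[OF S] finK by (simp add: card_Un_disjoint)
  also have "\<dots> \<le> order G" unfolding order_def
    using S K finite_carrier by (intro card_mono) auto
  finally have "card K * ((k + l) * m + 2) \<le> card K * (d + (k + l))"
    using kn n by (simp add: algebra_simps)
  then have "(k + l) * m + 2 \<le> d + (k + l)" using Kpos by (simp only: mult_le_cancel1)
  then have "(real k + real l) * real m + 2 \<le> real d + (real k + real l)"
    by (metis of_nat_add of_nat_le_iff of_nat_mult of_nat_numeral)
  then have "(real m - 1) * real (k + l) \<le> real d - 2" by (simp add: algebra_simps)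
  moreover have "real (k + l) > 0" using pos by linarith
  ultimately have "real m - 1 \<le> (real d - 2) / real (k + l)" by (simp only: pos_le_divide_eq)
  then have "real_of_int (int m - 1) \<le> (real d - 2) / real (k + l)" by simp
  then have fl: "int m \<le> \<lfloor>(real d - 2) / real (k + l)\<rfloor> + 1" by linarith
  have "card A \<le> card (A <#> K)"
    by (intro card_mono finite_sub set_mult_closed superset_set_mult_subgroup A K)
  then have "int (card A) \<le> int m * int (card K)" using m by (metis of_nat_le_iff of_nat_mult)
  also have "\<dots> \<le> (\<lfloor>(real d - 2) / real (k + l)\<rfloor> + 1) * int (card K)"
    using fl by (intro mult_right_mono) auto
  also have "card K = order G div d" using n dpos by simp
  finally show ?thesis using n by (intro exI[of _ d]) simp
qed

section \<open>A homomorphism onto the cyclic group of order the exponent\<close>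

lemma ord_mult_coprime:
  assumes x: "x \<in> carrier G" and y: "y \<in> carrier G" and cop: "coprime (ord x) (ord y)"
  shows "ord (x \<otimes> y) = ord x * ord y"
proof -
  have half: "ord a dvd ord (a \<otimes> b)"
    if a: "a \<in> carrier G" and b: "b \<in> carrier G" and c: "coprime (ord a) (ord b)" for a b
  proof -
    let ?N = "ord (a \<otimes> b) * ord b"
    have "(a \<otimes> b) [^] ?N = \<one>" using a b by (simp add: pow_eq_id)
    moreover have "(a \<otimes> b) [^] ?N = a [^] ?N \<otimes> b [^] ?N" using a b by (intro nat_pow_distrib)
    moreover have "b [^] ?N = \<one>" using b by (simp add: pow_eq_id)
    ultimately have "a [^] ?N = \<one>" using a by simp
    then have "ord a dvd ?N" using a by (simp add: pow_eq_id)
    then show ?thesis using c by (simp add: coprime_dvd_mult_left_iff)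
  qed
  have "ord x dvd ord (x \<otimes> y)" using half[OF x y cop] .
  moreover have "ord y dvd ord (x \<otimes> y)"
    using half[OF y x] cop m_comm[OF x y] by (simp add: coprime_commute)
  ultimately have "ord x * ord y dvd ord (x \<otimes> y)" using cop by (simp add: divides_mult)
  then show ?thesis using abelian_ord_mul_divides[OF x y] by (simp add: dvd_antisym)
qed

text \<open>
  If a prime \<open>p\<close> divided \<open>ord x\<close> to a higher power than \<open>ord g\<close>, then the \<open>p\<close>-part of \<open>x\<close> times the
  part of \<open>g\<close> of order prime to \<open>p\<close> would have an order exceeding \<open>ord g\<close>.
\<close>

lemma ord_dvd_maximal_ord:
  assumes g: "g \<in> carrier G" and max: "\<And>y. y \<in> carrier G \<Longrightarrow> ord y \<le> ord g"
    and x: "x \<in> carrier G"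
  shows "ord x dvd ord g"
proof (rule ccontr)
  assume nd: "\<not> ord x dvd ord g"
  have pos: "ord x \<noteq> 0" "ord g \<noteq> 0"
    using ord_ge_1[OF finite_carrier x] ord_ge_1[OF finite_carrier g] by auto
  obtain p where p: "prime p" "multiplicity p (ord g) < multiplicity p (ord x)"
    using nd multiplicity_le_imp_dvd[OF pos(1), of "ord g"] not_le by blast
  define a b where "a = multiplicity p (ord x)" and "b = multiplicity p (ord g)"
  have nu: "\<not> is_unit p" using p(1) by (simp add: prime_nat_iff)
  obtain r where r: "ord x = p ^ a * r" using multiplicity_dvd[of p "ord x"] by (auto simp: a_def dvd_def)
  obtain s where s: "ord g = p ^ b * s" "\<not> p dvd s"
    using multiplicity_decompose'[OF pos(2) nu] b_def by metis
  have p0: "p > 0" using p(1) by (simp add: prime_gt_0_nat)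
  have rs: "r \<noteq> 0" "s \<noteq> 0" using pos r s by auto
  have x': "ord (x [^] r) = p ^ a" using ord_pow[OF x, of r] r rs by simp
  have g': "ord (g [^] (p ^ b)) = s" using ord_pow[OF g, of "p ^ b"] s p0 by simp
  have "coprime (p ^ a) s" using s(2) p(1) by (simp add: prime_imp_coprime)
  then have "ord (x [^] r \<otimes> g [^] (p ^ b)) = p ^ a * s"
    using ord_mult_coprime[of "x [^] r" "g [^] (p ^ b)"] x g x' g' by simp
  moreover have "x [^] r \<otimes> g [^] (p ^ b) \<in> carrier G" using x g by simp
  ultimately have "p ^ a * s \<le> p ^ b * s" using max s(1) by metis
  then have "p ^ a \<le> p ^ b" using rs by simp
  moreover have "p ^ b < p ^ a" using p prime_gt_1_nat[OF p(1)] by (simp add: a_def b_def)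
  ultimately show False by simp
qed

text \<open>
  A homomorphism to \<open>\<int>/v\<close> is represented by integers that matter only modulo \<open>v\<close>, so that the
  same function also serves as a homomorphism to \<open>\<int>/d\<close> for each \<open>d dvd v\<close>.
\<close>

definition hom_mod :: "nat \<Rightarrow> 'a set \<Rightarrow> ('a \<Rightarrow> int) \<Rightarrow> bool" where
  "hom_mod v H f \<longleftrightarrow> (\<forall>x\<in>H. \<forall>y\<in>H. [f (x \<otimes> y) = f x + f y] (mod int v))"

lemma hom_modD: "hom_mod v H f \<Longrightarrow> x \<in> H \<Longrightarrow> y \<in> H \<Longrightarrow> [f (x \<otimes> y) = f x + f y] (mod int v)"
  by (simp add: hom_mod_def)

lemma hom_mod_one:
  assumes "hom_mod v H f" "subgroup H G"
  shows "[f \<one> = 0] (mod int v)"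
proof -
  have "\<one> \<in> H" using assms(2) by (rule subgroup.one_closed)
  then have "[f (\<one> \<otimes> \<one>) = f \<one> + f \<one>] (mod int v)" by (intro hom_modD[OF assms(1)])
  then have "[f \<one> = f \<one> + f \<one>] (mod int v)" by simp
  then have "int v dvd f \<one> - (f \<one> + f \<one>)" unfolding cong_iff_dvd_diff .
  then show ?thesis by (simp add: cong_0_iff)
qed

lemma hom_mod_int_pow:
  assumes f: "hom_mod v H f" and H: "subgroup H G" and y: "y \<in> H"
  shows "[f (y [^] (j::int)) = j * f y] (mod int v)"
proof -
  have yc: "y \<in> carrier G" using H y by (rule subgroup.mem_carrier)
  have powH: "y [^] (i::int) \<in> H" for i using subgroup_int_pow_closed[OF H y] .
  have nat: "[f (y [^] int i) = int i * f y] (mod int v)" for i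
  proof (induction i)
    case 0
    then show ?case using hom_mod_one[OF f H] by simp
  next
    case (Suc i)
    have "y [^] int (Suc i) = y \<otimes> y [^] int i" 
      using yc int_pow_mult[of y 1 "int i"] by (simp add: int_pow_1)
    then have "[f (y [^] int (Suc i)) = f y + f (y [^] int i)] (mod int v)"
      using hom_modD[OF f y powH] by simp
    also have "[f y + f (y [^] int i) = f y + int i * f y] (mod int v)"
      by (intro cong_add cong_refl Suc)
    finally show ?case by (simp add: algebra_simps)
  qed
  show ?thesis
  proof (cases j rule: int_cases2)
    case (nonneg n)
    then show ?thesis using nat by simp
  next
    case (nonpos n)
    have "y [^] int n \<otimes> y [^] j = \<one>" using yc nonpos by (simp add: int_pow_neg)
    then have "[f \<one> = f (y [^] int n) + f (y [^] j)] (mod int v)"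
      using hom_modD[OF f powH powH, of "int n" j] by simp
    then have "[f (y [^] int n) + f (y [^] j) = 0] (mod int v)"
      using hom_mod_one[OF f H] cong_sym cong_trans by blast
    moreover have "[f (y [^] int n) + f (y [^] j) = int n * f y + f (y [^] j)] (mod int v)"
      by (intro cong_add cong_refl nat)
    ultimately have "[int n * f y + f (y [^] j) = 0] (mod int v)" using cong_sym cong_trans by blast
    then have "int v dvd f (y [^] j) - j * f y" using nonpos by (simp add: cong_iff_dvd_diff algebra_simps)
    then show ?thesis by (simp add: cong_iff_dvd_diff)
  qed
qed

lemma subgroup_int_powers:
  assumes "x \<in> carrier G"
  shows "subgroup (range (\<lambda>i::int. x [^] i)) G"
proof (rule subgroupI)
  show "range (\<lambda>i::int. x [^] i) \<subseteq> carrier G" "range (\<lambda>i::int. x [^] i) \<noteq> {}" using assms by auto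
next
  fix a assume "a \<in> range (\<lambda>i::int. x [^] i)"
  then obtain i where "a = x [^] (i::int)" by auto
  then have "inv a = x [^] (- i)" using assms by (simp add: int_pow_neg)
  then show "inv a \<in> range (\<lambda>i::int. x [^] i)" by auto
next
  fix a b assume "a \<in> range (\<lambda>i::int. x [^] i)" "b \<in> range (\<lambda>i::int. x [^] i)"
  then obtain i j where "a = x [^] (i::int)" "b = x [^] (j::int)" by auto
  then have "a \<otimes> b = x [^] (i + j)" using assms by (simp add: int_pow_mult)
  then show "a \<otimes> b \<in> range (\<lambda>i::int. x [^] i)" by auto
qed

text \<open>
  The value \<open>z\<close> at the new element can be prescribed freely, subject to agreeing with \<open>f\<close> on the
  powers of \<open>x\<close> that already lie in \<open>H\<close>. This is exactly what makes \<open>f h + i z\<close> independent of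
  the way in which an element is written as \<open>h x\<^sup>i\<close>.
\<close>

lemma adjoin_hom_mod:
  assumes H: "subgroup H G" and f: "hom_mod v H f" and x: "x \<in> carrier G"
    and z: "\<And>i. x [^] (i::int) \<in> H \<Longrightarrow> [f (x [^] i) = i * z] (mod int v)"
  obtains f' where "hom_mod v (H <#> range (\<lambda>i::int. x [^] i)) f'"
    and "\<And>h. h \<in> H \<Longrightarrow> [f' h = f h] (mod int v)" and "[f' x = z] (mod int v)"
proof -
  have Hc: "h \<in> carrier G" if "h \<in> H" for h using H that by (rule subgroup.mem_carrier)
  have wd: "[f h + i * z = f h' + i' * z] (mod int v)"
    if hh: "h \<in> H" "h' \<in> H" and eq: "h \<otimes> x [^] i = h' \<otimes> x [^] i'" for h h' and i i' :: int
  proof -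
    have "x [^] (i - i') = x [^] i \<otimes> inv (x [^] i')" using x by (simp add: int_pow_diff)
    also have "\<dots> = inv h \<otimes> (h \<otimes> x [^] i) \<otimes> inv (x [^] i')"
      using x hh Hc by (simp add: flip: m_assoc)
    also have "\<dots> = inv h \<otimes> h'" unfolding eq using x hh Hc by (simp add: m_assoc)
    finally have e: "x [^] (i - i') = inv h \<otimes> h'" .
    then have inH: "x [^] (i - i') \<in> H" using H hh by (simp add: subgroup.m_closed subgroup.m_inv_closed)
    have "h \<otimes> x [^] (i - i') = h'" unfolding e using hh Hc by (simp flip: m_assoc)
    then have "[f h' = f h + f (x [^] (i - i'))] (mod int v)" using hom_modD[OF f hh(1) inH] by simp
    also have "[f h + f (x [^] (i - i')) = f h + (i - i') * z] (mod int v)"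
      by (intro cong_add cong_refl z inH)
    finally have "[f h' + i' * z = (f h + (i - i') * z) + i' * z] (mod int v)"
      by (intro cong_add cong_refl)
    then show ?thesis by (simp add: algebra_simps cong_sym)
  qed
  \<comment> \<open>A representation \<open>h x\<^sup>i\<close> of each element is chosen; by \<open>wd\<close> the choice is irrelevant modulo \<open>v\<close>.\<close>
  define f' where "f' y = (case SOME hi. fst hi \<in> H \<and> y = fst hi \<otimes> x [^] (snd hi :: int) of (h, i) \<Rightarrow> f h + i * z)" for y
  have f': "[f' (h \<otimes> x [^] i) = f h + i * z] (mod int v)" if h: "h \<in> H" for h and i :: int
  proof -
    let ?P = "\<lambda>hi. fst hi \<in> H \<and> h \<otimes> x [^] i = fst hi \<otimes> x [^] (snd hi :: int)"
    have "?P (Eps ?P)" by (rule someI[of ?P "(h, i)"]) (use h in simp)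
    then show ?thesis unfolding f'_def using wd[of "fst (Eps ?P)" h "snd (Eps ?P)" i] h
      by (simp add: case_prod_unfold)
  qed
  show ?thesis
  proof (rule that[of f'])
    show "hom_mod v (H <#> range (\<lambda>i::int. x [^] i)) f'" unfolding hom_mod_def
    proof (intro ballI)
      fix a b assume "a \<in> H <#> range (\<lambda>i::int. x [^] i)" "b \<in> H <#> range (\<lambda>i::int. x [^] i)"
      then obtain h i h' j where ab: "h \<in> H" "a = h \<otimes> x [^] (i::int)" "h' \<in> H" "b = h' \<otimes> x [^] (j::int)"
        by (auto simp: in_set_mult_iff)
      have "a \<otimes> b = (h \<otimes> h') \<otimes> (x [^] i \<otimes> x [^] j)"
        using ab x Hc by (simp add: m_ac)
      also have "\<dots> = (h \<otimes> h') \<otimes> x [^] (i + j)" using x by (simp add: int_pow_mult)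
      finally have "[f' (a \<otimes> b) = f (h \<otimes> h') + (i + j) * z] (mod int v)"
        using f'[of "h \<otimes> h'" "i + j"] ab H by (simp add: subgroup.m_closed)
      also have "[f (h \<otimes> h') + (i + j) * z = (f h + f h') + (i + j) * z] (mod int v)"
        by (intro cong_add cong_refl hom_modD[OF f] ab)
      also have "(f h + f h') + (i + j) * z = (f h + i * z) + (f h' + j * z)" by (simp add: algebra_simps)
      also have "[(f h + i * z) + (f h' + j * z) = f' a + f' b] (mod int v)"
        unfolding ab by (intro cong_add cong_sym[OF f'] ab)
      finally show "[f' (a \<otimes> b) = f' a + f' b] (mod int v)" .
    qed
    show "[f' h = f h] (mod int v)" if "h \<in> H" for h
      using f'[OF that, of 0] that Hc x by simp
    have "\<one> \<in> H" using H by (rule subgroup.one_closed)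
    then have "[f' (\<one> \<otimes> x [^] (1::int)) = f \<one> + 1 * z] (mod int v)" by (rule f')
    also have "[f \<one> + 1 * z = 0 + 1 * z] (mod int v)" by (intro cong_add cong_refl hom_mod_one[OF f H])
    finally show "[f' x = z] (mod int v)" using x by (simp add: int_pow_1)
  qed
qed

text \<open>
  A value suitable for \<open>adjoin_hom_mod\<close> always exists. The exponents \<open>i\<close> with \<open>x\<^sup>i \<in> H\<close> are the
  multiples of some \<open>m\<close>, and \<open>m\<close> divides \<open>v\<close>, say \<open>v = m w\<close>. So \<open>w f(x\<^sup>m)\<close> is congruent to
  \<open>f(x\<^sup>v) = f(\<one>)\<close>, that is to \<open>0\<close>, modulo \<open>m w\<close>; hence \<open>m\<close> divides \<open>f(x\<^sup>m)\<close>, and the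
  quotient is the required value. The divisibility of \<open>v\<close> by \<open>m\<close> comes from \<open>x\<^sup>v = \<one>\<close>.
\<close>

lemma hom_mod_divisible:
  assumes H: "subgroup H G" and f: "hom_mod v H f" and x: "x \<in> carrier G"
    and v: "v > 0" "x [^] v = \<one>"
  obtains z where "\<And>i. x [^] (i::int) \<in> H \<Longrightarrow> [f (x [^] i) = i * z] (mod int v)"
proof -
  define m where "m = (LEAST n::nat. n > 0 \<and> x [^] int n \<in> H)"
  have one: "\<one> \<in> H" using H by (rule subgroup.one_closed)
  have vH: "x [^] int v = \<one>" using v(2) by (simp add: int_pow_int)
  have ex: "v > 0 \<and> x [^] int v \<in> H" using v(1) vH one by simp
  have m: "m > 0" "x [^] int m \<in> H" using LeastI[of "\<lambda>n::nat. n > 0 \<and> x [^] int n \<in> H", OF ex] by (auto simp: m_def)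
  have dvd: "int m dvd i" if i: "x [^] (i::int) \<in> H" for i
  proof (rule ccontr)
    assume "\<not> int m dvd i"
    then have ne: "i mod int m \<noteq> 0" by (simp add: dvd_eq_mod_eq_0)
    define r where "r = nat (i mod int m)"
    have r: "int r = i mod int m" using m(1) by (simp add: r_def)
    have "x [^] (i mod int m) = x [^] (i - int m * (i div int m))" by (simp add: minus_mult_div_eq_mod)
    also have "\<dots> = x [^] i \<otimes> inv ((x [^] int m) [^] (i div int m))"
      using x by (simp add: int_pow_diff int_pow_pow)
    also have "\<dots> \<in> H"
      by (intro subgroup.m_closed[OF H] i subgroup.m_inv_closed[OF H] subgroup_int_pow_closed[OF H] m)
    finally have "r > 0 \<and> x [^] int r \<in> H" using ne r by auto
    then have "m \<le> r" unfolding m_def by (rule Least_le)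
    then show False using r m(1) pos_mod_bound[of "int m" i] by linarith
  qed
  obtain w where w: "int v = int m * w" using dvd[of "int v"] ex by (auto simp: dvd_def)
  have mult: "[f (x [^] (int m * j)) = j * f (x [^] int m)] (mod int v)" for j
    using hom_mod_int_pow[OF f H m(2), of j] x by (simp add: int_pow_pow)
  have "[w * f (x [^] int m) = f \<one>] (mod int v)" using mult[of w] vH w by (simp add: cong_sym)
  then have "[w * f (x [^] int m) = 0] (mod int v)" using hom_mod_one[OF f H] cong_trans by blast
  then have "w * int m dvd w * f (x [^] int m)" by (simp add: cong_0_iff w mult.commute)
  moreover have "w \<noteq> 0" using w v(1) by auto
  ultimately have "int m dvd f (x [^] int m)" by simp
  then obtain z where z: "f (x [^] int m) = int m * z" by (auto simp: dvd_def)
  show ?thesis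
  proof (rule that[of z])
    fix i :: int assume "x [^] i \<in> H"
    then obtain j where "i = int m * j" using dvd by (auto simp: dvd_def)
    then show "[f (x [^] i) = i * z] (mod int v)" using mult[of j] z by (simp add: mult_ac)
  qed
qed

lemma extend_hom_mod:
  assumes v: "v > 0" "\<And>x. x \<in> carrier G \<Longrightarrow> x [^] v = \<one>"
  shows "subgroup H G \<Longrightarrow> hom_mod v H f \<Longrightarrow>
    \<exists>f'. hom_mod v (carrier G) f' \<and> (\<forall>h\<in>H. [f' h = f h] (mod int v))"
proof (induction "card (carrier G) - card H" arbitrary: H f rule: less_induct)
  case less
  have Hc: "H \<subseteq> carrier G" using less.prems(1) by (rule subgroup.subset)
  show ?case
  proof (cases "H = carrier G")
    case True
    then show ?thesis using less.prems by auto
  next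
    case False
    then obtain x where x: "x \<in> carrier G" "x \<notin> H" using Hc by auto
    obtain z where z: "\<And>i. x [^] (i::int) \<in> H \<Longrightarrow> [f (x [^] i) = i * z] (mod int v)"
      using hom_mod_divisible[OF less.prems x(1) v(1) v(2)[OF x(1)]] by blast
    let ?X = "range (\<lambda>i::int. x [^] i)"
    let ?H' = "H <#> ?X"
    obtain f1 where f1: "hom_mod v ?H' f1" "\<And>h. h \<in> H \<Longrightarrow> [f1 h = f h] (mod int v)"
      using adjoin_hom_mod[OF less.prems x(1) z] by blast
    have X: "subgroup ?X G" using x(1) by (rule subgroup_int_powers)
    have H': "subgroup ?H' G" using less.prems(1) X by (rule mult_subgroups)
    have sub: "H \<subseteq> ?H'" by (rule superset_set_mult_subgroup[OF X Hc])
    have "\<one> \<otimes> x [^] (1::int) \<in> ?H'"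
      by (intro set_multI subgroup.one_closed[OF less.prems(1)]) auto
    then have "x \<in> ?H'" using x(1) by (simp add: int_pow_1)
    then have "H \<subset> ?H'" using sub x(2) by auto
    moreover have H'c: "?H' \<subseteq> carrier G" using H' by (rule subgroup.subset)
    ultimately have "card H < card ?H'" "card ?H' \<le> card (carrier G)"
      using finite_carrier finite_sub[OF H'c] by (auto intro: psubset_card_mono card_mono)
    then have "card (carrier G) - card ?H' < card (carrier G) - card H" by linarith
    from less.hyps[OF this H' f1(1)] obtain f' where f': "hom_mod v (carrier G) f'"
      "\<forall>h\<in>?H'. [f' h = f1 h] (mod int v)" by blast
    have "[f' h = f h] (mod int v)" if "h \<in> H" for h
      using f'(2) f1(2)[OF that] sub that cong_trans by blast
    then show ?thesis using f'(1) by blast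
  qed
qed

text \<open>
  On the trivial subgroup the value \<open>1\<close> is admissible for \<open>g\<close> because \<open>ord g\<close> is the modulus; the
  resulting homomorphism on the powers of \<open>g\<close> is then extended.
\<close>

lemma hom_mod_maximal_ord:
  assumes g: "g \<in> carrier G" and max: "\<And>y. y \<in> carrier G \<Longrightarrow> ord y \<le> ord g"
  obtains f where "hom_mod (ord g) (carrier G) f" "[f g = 1] (mod int (ord g))"
proof -
  let ?v = "ord g"
  have v: "?v > 0" using ord_ge_1[OF finite_carrier g] by simp
  have kill: "x [^] ?v = \<one>" if "x \<in> carrier G" for x
    using ord_dvd_maximal_ord[OF g max that] that by (simp add: pow_eq_id)
  have triv: "subgroup {\<one>} G" by (rule triv_subgroup)
  have h0: "hom_mod ?v {\<one>} (\<lambda>_. 0)" by (simp add: hom_mod_def)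
  let ?X = "range (\<lambda>i::int. g [^] i)"
  have z: "[0 = i * 1] (mod int ?v)" if "g [^] (i::int) \<in> {\<one>}" for i
    using that int_pow_eq_id[OF g, of i] by (simp add: cong_0_iff cong_sym_eq[of 0])
  obtain f1 where f1: "hom_mod ?v ({\<one>} <#> ?X) f1" "[f1 g = 1] (mod int ?v)"
    using adjoin_hom_mod[OF triv h0 g z] by blast
  have X: "subgroup ?X G" using g by (rule subgroup_int_powers)
  obtain f where f: "hom_mod ?v (carrier G) f" "\<forall>h\<in>{\<one>} <#> ?X. [f h = f1 h] (mod int ?v)"
    using extend_hom_mod[OF v kill mult_subgroups[OF triv X] f1(1)] by blast
  have "\<one> \<otimes> g [^] (1::int) \<in> {\<one>} <#> ?X" by (intro set_multI) auto
  then have "[f g = f1 g] (mod int ?v)" using f(2) g by (simp add: int_pow_1)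
  then show ?thesis using that f(1) f1(2) cong_trans by blast
qed

section \<open>The lower bound\<close>

text \<open>
  Multiplication by a power of \<open>g\<close> maps any fibre injectively into any other one, so that all
  \<open>d\<close> fibres are equally large.
\<close>

lemma card_fibre_hom_mod:
  assumes f: "hom_mod d (carrier G) f" and d: "d > 0"
    and g: "g \<in> carrier G" "[f g = 1] (mod int d)"
  shows "card {x \<in> carrier G. [f x = r] (mod int d)} = order G div d"
proof -
  define F where "F r = {x \<in> carrier G. [f x = r] (mod int d)}" for r
  have Fc: "F r \<subseteq> carrier G" for r by (auto simp: F_def)
  have le: "card (F r) \<le> card (F s)" for r s
  proof -
    let ?y = "g [^] (s - r)"
    have y: "?y \<in> carrier G" using g by simp
    have "[f ?y = (s - r) * f g] (mod int d)" by (rule hom_mod_int_pow[OF f subgroup_self g(1)])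
    also have "[(s - r) * f g = (s - r) * 1] (mod int d)" by (intro cong_mult cong_refl g)
    finally have fy: "[f ?y = s - r] (mod int d)" by simp
    have "?y <# F r \<subseteq> F s"
    proof
      fix u assume "u \<in> ?y <# F r"
      then obtain x where x: "x \<in> carrier G" "[f x = r] (mod int d)" "u = ?y \<otimes> x"
        by (auto simp: l_coset_def F_def)
      have "[f u = f ?y + f x] (mod int d)" unfolding x(3) by (rule hom_modD[OF f y x(1)])
      also have "[f ?y + f x = (s - r) + r] (mod int d)" by (intro cong_add fy x)
      finally show "u \<in> F s" using x y by (simp add: F_def)
    qed
    then have "card (?y <# F r) \<le> card (F s)" by (intro card_mono finite_sub Fc)
    then show ?thesis using card_l_coset[OF y Fc] by simp
  qed
  have eq: "card (F s) = card (F r)" for s using le[of r s] le[of s r] by simp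
  have "carrier G = (\<Union>j\<in>{..<d}. F (int j))"
  proof
    show "carrier G \<subseteq> (\<Union>j\<in>{..<d}. F (int j))"
    proof
      fix x assume x: "x \<in> carrier G"
      have "int (nat (f x mod int d)) = f x mod int d" using d by simp
      then have "x \<in> F (int (nat (f x mod int d)))" using x by (simp add: F_def cong_def)
      moreover have "nat (f x mod int d) < d" using d by (simp add: nat_less_iff)
      ultimately show "x \<in> (\<Union>j\<in>{..<d}. F (int j))" by blast
    qed
  qed (use Fc in auto)
  then have "order G = card (\<Union>j\<in>{..<d}. F (int j))" by (simp add: order_def)
  also have "\<dots> = (\<Sum>j\<in>{..<d}. card (F (int j)))"
  proof (rule card_UN_disjoint)
    show "\<forall>i\<in>{..<d}. finite (F (int i))" using finite_sub[OF Fc] by blast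
    show "\<forall>i\<in>{..<d}. \<forall>j\<in>{..<d}. i \<noteq> j \<longrightarrow> F (int i) \<inter> F (int j) = {}"
      by (auto simp: F_def cong_def)
  qed simp
  also have "\<dots> = (\<Sum>j\<in>{..<d}. card (F r))" by (intro sum.cong refl eq)
  finally show ?thesis using d by (simp flip: F_def)
qed

lemma hfold_sumset_residues:
  assumes f: "hom_mod d (carrier G) f" and A: "A \<subseteq> carrier G"
    and int: "\<And>x. x \<in> A \<Longrightarrow> \<exists>r. 0 \<le> r \<and> r \<le> q \<and> [f x = c + r] (mod int d)"
  shows "x \<in> hfold_sumset G h A \<Longrightarrow> \<exists>r. 0 \<le> r \<and> r \<le> int h * q \<and> [f x = int h * c + r] (mod int d)"
proof (induction h arbitrary: x)
  case 0
  then show ?case using hom_mod_one[OF f subgroup_self] by (auto simp: hfold_sumset_0)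
next
  case (Suc h)
  then obtain a y where ay: "a \<in> A" "y \<in> hfold_sumset G h A" "x = a \<otimes> y"
    using A by (auto simp: hfold_sumset_Suc in_set_mult_iff)
  have "hfold_sumset G h A \<subseteq> carrier G" using A by (auto simp: hfold_sumset_eq_sumset intro!: sumset_carrier)
  then have c: "a \<in> carrier G" "y \<in> carrier G" using ay A by auto
  obtain r s where r: "0 \<le> r" "r \<le> q" "[f a = c + r] (mod int d)"
    and s: "0 \<le> s" "s \<le> int h * q" "[f y = int h * c + s] (mod int d)"
    using int[OF ay(1)] Suc.IH[OF ay(2)] by auto
  have "[f x = f a + f y] (mod int d)" unfolding ay(3) by (rule hom_modD[OF f c])
  also have "[f a + f y = (c + r) + (int h * c + s)] (mod int d)" by (intro cong_add r s)
  finally have "[f x = int (Suc h) * c + (r + s)] (mod int d)" by (simp add: algebra_simps)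
  moreover have "0 \<le> r + s" "r + s \<le> int (Suc h) * q" using r s by (auto simp: algebra_simps)
  ultimately show ?case by blast
qed

text \<open>
  Let \<open>A\<close> be the preimage of the residues \<open>c, \<dots>, c + q\<close>. A common element of the two sumsets of \<open>A\<close>
  would give a multiple of \<open>d\<close> of the form \<open>(k - l) c + i\<close> with \<open>- l q \<le> i \<le> k q\<close>. As \<open>c\<close>
  varies, \<open>(k - l) c\<close> runs through the multiples of \<open>\<delta> = gcd d (k - l)\<close> modulo \<open>d\<close>. It is therefore enough to
  find a multiple \<open>\<delta> t\<close> for which \<open>\<delta> t - l q\<close> and \<open>\<delta> t + k q\<close> both lie strictly between \<open>0\<close> and \<open>d\<close>; the
  least multiple exceeding \<open>l q\<close> will do.
\<close>

lemma interval_sum_free: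
  assumes f: "hom_mod d (carrier G) f" and g: "g \<in> carrier G" "[f g = 1] (mod int d)"
    and kl: "k > l" and q: "(k + l) * q + gcd d (k - l) < d"
  shows "\<exists>A. sum_free G k l A \<and> card A = (q + 1) * (order G div d)"
proof -
  have d: "d > 0" using q by simp
  define \<delta> where "\<delta> = gcd d (k - l)"
  \<comment> \<open>\<open>\<delta> t\<close> is the least multiple of \<open>\<delta>\<close> that exceeds \<open>l q\<close>.\<close>
  define t where "t = (l * q) div \<delta> + 1"
  have dpos: "\<delta> > 0" using d by (simp add: \<delta>_def)
  have "\<delta> * t = \<delta> * ((l * q) div \<delta>) + \<delta>" by (simp add: t_def algebra_simps)
  moreover have "l * q = \<delta> * ((l * q) div \<delta>) + (l * q) mod \<delta>" by simp
  moreover have "(l * q) mod \<delta> < \<delta>" using dpos by simp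
  ultimately have t1: "l * q < \<delta> * t" and t2: "\<delta> * t \<le> l * q + \<delta>" by linarith+
  obtain u w where uw: "u * int d + w * int (k - l) = int \<delta>"
    using bezout_int[of "int d" "int (k - l)"] unfolding \<delta>_def by (metis gcd_int_int_eq)
  define c where "c = w * int t"
  have "int (k - l) * c - int (\<delta> * t) = - (u * int t) * int d"
    using arg_cong[OF uw, of "\<lambda>z. z * int t"] by (simp add: c_def algebra_simps)
  then have cc: "[int (k - l) * c = int (\<delta> * t)] (mod int d)"
    by (simp add: cong_iff_dvd_diff)
  define F where "F r = {x \<in> carrier G. [f x = r] (mod int d)}" for r
  define A where "A = (\<Union>j\<in>{..q}. F (c + int j))"
  have Ac: "A \<subseteq> carrier G" by (auto simp: A_def F_def)
  have qd: "q < d"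
  proof -
    have "q \<le> (k + l) * q" using kl by simp
    then show ?thesis using q by linarith
  qed
  have "card A = (\<Sum>j\<in>{..q}. card (F (c + int j)))" unfolding A_def
  proof (rule card_UN_disjoint)
    show "\<forall>i\<in>{..q}. finite (F (c + int i))" by (auto intro!: finite_sub simp: F_def)
    show "\<forall>i\<in>{..q}. \<forall>j\<in>{..q}. i \<noteq> j \<longrightarrow> F (c + int i) \<inter> F (c + int j) = {}"
    proof (intro ballI impI, rule ccontr)
      fix i j assume ij: "i \<in> {..q}" "j \<in> {..q}" "i \<noteq> j" "F (c + int i) \<inter> F (c + int j) \<noteq> {}"
      then obtain x where "[f x = c + int i] (mod int d)" "[f x = c + int j] (mod int d)" by (auto simp: F_def)
      then have "[c + int i = c + int j] (mod int d)" using cong_sym cong_trans by blast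
      then have "[int i = int j] (mod int d)" by (simp add: cong_add_lcancel)
      then show False using ij qd by (simp add: cong_def)
    qed
  qed simp
  also have "\<dots> = (q + 1) * (order G div d)"
    using card_fibre_hom_mod[OF f d g] by (simp add: F_def)
  finally have card: "card A = (q + 1) * (order G div d)" .
  have int: "\<exists>r. 0 \<le> r \<and> r \<le> int q \<and> [f x = c + r] (mod int d)" if x: "x \<in> A" for x
  proof -
    obtain j where "j \<le> q" "[f x = c + int j] (mod int d)" using x by (auto simp: A_def F_def)
    then show ?thesis by (intro exI[of _ "int j"]) simp
  qed
  have "hfold_sumset G k A \<inter> hfold_sumset G l A = {}"
  proof (rule ccontr)
    assume "hfold_sumset G k A \<inter> hfold_sumset G l A \<noteq> {}"
    then obtain x where x: "x \<in> hfold_sumset G k A" "x \<in> hfold_sumset G l A" by auto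
    obtain r where r: "0 \<le> r" "r \<le> int k * int q" "[f x = int k * c + r] (mod int d)"
      using hfold_sumset_residues[OF f Ac int x(1)] by auto
    obtain s where s: "0 \<le> s" "s \<le> int l * int q" "[f x = int l * c + s] (mod int d)"
      using hfold_sumset_residues[OF f Ac int x(2)] by auto
    have "[int k * c + r = int l * c + s] (mod int d)" using r(3) s(3) cong_sym cong_trans by blast
    then have "int d dvd (int k * c + r) - (int l * c + s)" by (simp add: cong_iff_dvd_diff)
    moreover have "int d dvd int (k - l) * c - int (\<delta> * t)" using cc by (simp add: cong_iff_dvd_diff)
    ultimately have "int d dvd ((int k * c + r) - (int l * c + s)) - (int (k - l) * c - int (\<delta> * t))"
      by (rule dvd_diff)
    also have "\<dots> = int (\<delta> * t) + r - s" using kl by (simp add: of_nat_diff algebra_simps)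
    finally have dv: "int d dvd int (\<delta> * t) + r - s" .
    have "int (l * q) < int (\<delta> * t)" "int (\<delta> * t) \<le> int (l * q) + int \<delta>" using t1 t2 by linarith+
    moreover have "int ((k + l) * q) + int \<delta> < int d" using q by (simp only: \<delta>_def of_nat_add[symmetric] of_nat_less_iff)
    ultimately have "0 < int (\<delta> * t) + r - s" "int (\<delta> * t) + r - s < int d"
      using r s by (auto simp: algebra_simps)
    then show False using dv zdvd_not_zless by blast
  qed
  then show ?thesis using Ac card by (auto simp: sum_free_def)
qed

section \<open>The largest size of a sum-free set\<close>

lemma finite_sum_free_cards: "finite {card A | A. sum_free G k l A}"
proof (rule finite_subset)
  show "{card A | A. sum_free G k l A} \<subseteq> card ` Pow (carrier G)" by (auto simp: sum_free_def)
qed (simp add: finite_carrier)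

lemma card_le_max_sum_free_size:
  assumes "sum_free G k l A"
  shows "card A \<le> max_sum_free_size G k l"
  unfolding max_sum_free_size_def using assms by (intro Max_ge finite_sum_free_cards) auto

lemma max_sum_free_size_attained:
  assumes "k > 0" "l > 0"
  obtains A where "sum_free G k l A" "card A = max_sum_free_size G k l"
proof -
  have "{..<k} \<noteq> {}" using assms by auto
  then have "sum_free G k l {}" by (auto simp: sum_free_def hfold_sumset_def)
  then have "{card A | A. sum_free G k l A} \<noteq> {}" by auto
  then have "max_sum_free_size G k l \<in> {card A | A. sum_free G k l A}"
    unfolding max_sum_free_size_def by (intro Max_in finite_sum_free_cards)
  then show ?thesis using that by auto
qed

end

theorem theorem3:
  fixes G :: "('a, 'b) monoid_scheme" and k l n v :: nat
  assumes "comm_group G" and "finite (carrier G)"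
    and "n = order G" and "n > 1"
    and "v = group_exponent G"
    and "l > 0" and "k > l"
  shows "Max {(\<lfloor>(real d - 1 - real (gcd d (k - l))) / real (k + l)\<rfloor> + 1) * int (n div d) | d. d dvd v}
           \<le> int (max_sum_free_size G k l) \<and>
         int (max_sum_free_size G k l)
           \<le> Max {(\<lfloor>(real d - 2) / real (k + l)\<rfloor> + 1) * int (n div d) | d. d dvd n}"
proof -
  interpret comm_group G by fact
  interpret finite_comm_group G by unfold_locales fact
  let ?lower = "\<lambda>d. (\<lfloor>(real d - 1 - real (gcd d (k - l))) / real (k + l)\<rfloor> + 1) * int (n div d)"
  let ?upper = "\<lambda>d. (\<lfloor>(real d - 2) / real (k + l)\<rfloor> + 1) * int (n div d)"
  have "v \<in> ord ` carrier G" unfolding \<open>v = group_exponent G\<close> group_exponent_def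
    using finite_carrier by (intro Max_in) auto
  then obtain g where g: "g \<in> carrier G" "ord g = v" by auto
  have max: "ord y \<le> ord g" if "y \<in> carrier G" for y
    unfolding g(2) \<open>v = group_exponent G\<close> group_exponent_def
    using finite_carrier that by (intro Max_ge) auto
  have v: "v > 0" using ord_ge_1[OF finite_carrier g(1)] g(2) by simp
  obtain f where f: "hom_mod v (carrier G) f" "[f g = 1] (mod int v)"
    using hom_mod_maximal_ord[OF g(1) max] g(2) by auto
  have lower: "?lower d \<le> int (max_sum_free_size G k l)" if d: "d dvd v" for d
  proof (cases "\<lfloor>(real d - 1 - real (gcd d (k - l))) / real (k + l)\<rfloor> \<ge> 0")
    \<comment> \<open>The term of \<open>d\<close> is then at most \<open>0\<close>, so that any size bounds it.\<close>
    case False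
    then have "\<lfloor>(real d - 1 - real (gcd d (k - l))) / real (k + l)\<rfloor> + 1 \<le> 0" by linarith
    then have "?lower d \<le> 0" by (rule mult_nonpos_nonneg) simp
    then show ?thesis by linarith
  next
    case True
    define q where "q = nat \<lfloor>(real d - 1 - real (gcd d (k - l))) / real (k + l)\<rfloor>"
    have q: "int q = \<lfloor>(real d - 1 - real (gcd d (k - l))) / real (k + l)\<rfloor>" using True by (simp add: q_def)
    have "real q \<le> (real d - 1 - real (gcd d (k - l))) / real (k + l)"
      using of_int_floor_le[of "(real d - 1 - real (gcd d (k - l))) / real (k + l)"] q
      by (metis of_int_of_nat_eq)
    moreover have "real (k + l) > 0" using \<open>l > 0\<close> by simp
    ultimately have "real q * real (k + l) \<le> real d - 1 - real (gcd d (k - l))"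
      by (simp only: pos_le_divide_eq)
    then have "real ((k + l) * q + gcd d (k - l)) < real d" by (simp add: mult.commute)
    then have qd: "(k + l) * q + gcd d (k - l) < d" by (simp only: of_nat_less_iff)
    have fd: "hom_mod d (carrier G) f" "[f g = 1] (mod int d)"
      using f d cong_dvd_modulus[of _ _ "int v" "int d"] by (auto simp: hom_mod_def)
    obtain A where A: "sum_free G k l A" "card A = (q + 1) * (order G div d)"
      using interval_sum_free[OF fd(1) g(1) fd(2) \<open>k > l\<close> qd] by auto
    have "?lower d = (int q + 1) * int (n div d)" by (simp only: q)
    also have "\<dots> = int ((q + 1) * (n div d))" by (simp add: algebra_simps)
    also have "\<dots> = int (card A)" using A(2) \<open>n = order G\<close> by simp
    also have "\<dots> \<le> int (max_sum_free_size G k l)" using card_le_max_sum_free_size[OF A(1)] by simp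
    finally show ?thesis .
  qed
  have n: "n > 0" using \<open>n > 1\<close> by simp
  obtain A where A: "sum_free G k l A" "card A = max_sum_free_size G k l"
    using max_sum_free_size_attained[of k l] \<open>l > 0\<close> \<open>k > l\<close> by auto
  obtain d where d: "d dvd n" "int (card A) \<le> ?upper d"
    using sum_free_card_le[OF A(1)] \<open>l > 0\<close> \<open>n = order G\<close> by auto
  have "Max {?lower d | d. d dvd v} \<le> int (max_sum_free_size G k l)"
  proof (rule Max.boundedI)
    show "finite {?lower d | d. d dvd v}" using finite_divisors_nat[OF v] by simp
    show "{?lower d | d. d dvd v} \<noteq> {}" by auto
  qed (use lower in auto)
  moreover have "?upper d \<le> Max {?upper d | d. d dvd n}"
  proof (rule Max_ge)
    show "finite {?upper d | d. d dvd n}" using finite_divisors_nat[OF n] by simp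
  qed (use d in auto)
  ultimately show ?thesis using d(2) A(2) by auto
qed

end
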